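(* Let $H$ be a complex Hilbert space with $\dim H\geq 2$ and $B(H)^{++}$ the set of positive definite (positive semidefinite and invertible) bounded linear operators on $H$. Let $\sigma$ be a symmetric Kubo–Ando mean. Assume that there exists a continuous strictly increasing surjective function $g:]0,\infty[\to]0,\infty[$ such that the operation $A\diamond B=g(A\sigma B)$, $A,B\in B(H)^{++}$, is associative. Then $\sigma$ is either the arithmetic mean or the harmonic mean.
   Context: A Kubo–Ando mean $\sigma$ is determined by an operator monotone function $f:]0,\infty[\to]0,\infty[$ with $f(1)=1$ via $A\sigma B=A^{1/2}f(A^{-1/2}BA^{-1/2})A^{1/2}$ for $A,B\in B(H)^{++}$. It is symmetric if $tf(1/t)=f(t)$ for $t>0$. The arithmetic mean is $(A+B)/2$ (with $f(t)=(1+t)/2$); the harmonic mean is $2(A^{-1}+B^{-1})^{-1}$ (with $f(t)=2t/(1+t)$). $g(\cdot)$ applied to an operator is defined by continuous functional calculus. *)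

theory Defs
  imports "HOL-Analysis.Analysis" "HOL-Computational_Algebra.Polynomial"
begin

text \<open>A complex Hilbert space, presented via its realification: a real Hilbert space
  together with the real-linear isometry imult (multiplication by the imaginary unit),
  satisfying imult (imult x) = - x.  The complex inner product is recovered as cinner.\<close>

class complex_inner_space = real_inner +
  fixes imult :: "'a \<Rightarrow> 'a"
  assumes imult_add: "imult (x + y) = imult x + imult y"
    and imult_scaleR: "imult (r *\<^sub>R x) = r *\<^sub>R imult x"
    and imult_imult: "imult (imult x) = - x"
    and inner_imult: "inner (imult x) (imult y) = inner x y"

class chilbert = complex_inner_space + complete_space

definition cscale :: "complex \<Rightarrow> 'a::complex_inner_space \<Rightarrow> 'a" where
  "cscale c x = Re c *\<^sub>R x + Im c *\<^sub>R imult x"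

text \<open>Complex inner product, linear in the first argument.\<close>
definition cinner :: "'a::complex_inner_space \<Rightarrow> 'a \<Rightarrow> complex" where
  "cinner x y = Complex (inner x y) (inner x (imult y))"

definition BH :: "('a::chilbert \<Rightarrow>\<^sub>L 'a) set" where
  "BH = {A. \<forall>x. blinfun_apply A (imult x) = imult (blinfun_apply A x)}"

definition op_positive :: "('a::chilbert \<Rightarrow>\<^sub>L 'a) \<Rightarrow> bool" where
  "op_positive A \<longleftrightarrow> A \<in> BH \<and> (\<forall>x. Im (cinner (blinfun_apply A x) x) = 0 \<and> Re (cinner (blinfun_apply A x) x) \<ge> 0)"

definition op_le :: "('a::chilbert \<Rightarrow>\<^sub>L 'a) \<Rightarrow> ('a \<Rightarrow>\<^sub>L 'a) \<Rightarrow> bool" where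
  "op_le A B \<longleftrightarrow> op_positive (B - A)"

definition op_invertible :: "('a::chilbert \<Rightarrow>\<^sub>L 'a) \<Rightarrow> bool" where
  "op_invertible A \<longleftrightarrow> A \<in> BH \<and> (\<exists>B\<in>BH. A o\<^sub>L B = id_blinfun \<and> B o\<^sub>L A = id_blinfun)"

definition op_inv :: "('a::chilbert \<Rightarrow>\<^sub>L 'a) \<Rightarrow> ('a \<Rightarrow>\<^sub>L 'a)" where
  "op_inv A = (THE B. A o\<^sub>L B = id_blinfun \<and> B o\<^sub>L A = id_blinfun)"

definition PD :: "('a::chilbert \<Rightarrow>\<^sub>L 'a) set" where
  "PD = {A. op_positive A \<and> op_invertible A}"

text \<open>Real part of the spectrum (the whole spectrum for self-adjoint operators).\<close>
definition op_spec :: "('a::chilbert \<Rightarrow>\<^sub>L 'a) \<Rightarrow> real set" where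
  "op_spec A = {r. \<not> op_invertible (A - r *\<^sub>R id_blinfun)}"

definition op_pow :: "('a::chilbert \<Rightarrow>\<^sub>L 'a) \<Rightarrow> nat \<Rightarrow> ('a \<Rightarrow>\<^sub>L 'a)" where
  "op_pow A n = ((\<lambda>T. A o\<^sub>L T) ^^ n) id_blinfun"

definition poly_op :: "real poly \<Rightarrow> ('a::chilbert \<Rightarrow>\<^sub>L 'a) \<Rightarrow> ('a \<Rightarrow>\<^sub>L 'a)" where
  "poly_op p A = (\<Sum>k\<le>degree p. coeff p k *\<^sub>R op_pow A k)"

text \<open>Continuous functional calculus for self-adjoint operators: h(A) is the operator-norm
  limit of p_n(A) for any sequence of real polynomials p_n converging uniformly to h on the
  spectrum of A (Weierstrass).\<close>
definition fcalc :: "(real \<Rightarrow> real) \<Rightarrow> ('a::chilbert \<Rightarrow>\<^sub>L 'a) \<Rightarrow> ('a \<Rightarrow>\<^sub>L 'a)" where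
  "fcalc h A = (THE T. \<forall>p::nat \<Rightarrow> real poly.
      uniform_limit (op_spec A) (\<lambda>n t. poly (p n) t) h sequentially
      \<longrightarrow> (\<lambda>n. poly_op (p n) A) \<longlonglongrightarrow> T)"

definition kubo_ando :: "(real \<Rightarrow> real) \<Rightarrow> ('a::chilbert \<Rightarrow>\<^sub>L 'a) \<Rightarrow> ('a \<Rightarrow>\<^sub>L 'a) \<Rightarrow> ('a \<Rightarrow>\<^sub>L 'a)" where
  "kubo_ando f A B =
     fcalc sqrt A o\<^sub>L
     fcalc f (fcalc (\<lambda>t. 1 / sqrt t) A o\<^sub>L B o\<^sub>L fcalc (\<lambda>t. 1 / sqrt t) A) o\<^sub>L
     fcalc sqrt A"

definition infinite_dim :: "'b::chilbert itself \<Rightarrow> bool" where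
  "infinite_dim _ \<longleftrightarrow> (\<forall>S::'b set. finite S \<longrightarrow> span S \<noteq> UNIV)"

text \<open>Operator monotonicity of f on ]0,infinity[, tested on the positive definite
  operators of the Hilbert space 'b (equivalent to the usual notion when 'b is
  infinite-dimensional).\<close>
definition op_monotone :: "'b::chilbert itself \<Rightarrow> (real \<Rightarrow> real) \<Rightarrow> bool" where
  "op_monotone _ f \<longleftrightarrow> continuous_on {0<..} f \<and>
     (\<forall>A\<in>(PD::('b \<Rightarrow>\<^sub>L 'b) set). \<forall>B\<in>PD. op_le A B \<longrightarrow> op_le (fcalc f A) (fcalc f B))"

end

theory Submission
  imports Defs "HOL-Computational_Algebra.Fundamental_Theorem_Algebra"
begin

text \<open>
  In a two-dimensional block with generalised eigenvalues \<open>k, k'\<close> the mean of \<open>A\<close> and \<open>B\<close> is the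
  combination \<open>\<alpha> A + \<beta> B\<close>, where \<open>\<alpha> + \<beta> x\<close> interpolates \<open>f\<close> at \<open>k\<close> and \<open>k'\<close>. Put a scalar
  \<open>t\<close> in the middle of the associative law: with \<open>h x = g (t f (x / t))\<close> the mean of \<open>h(A)\<close> and \<open>C\<close>
  is the mean of \<open>A\<close> and \<open>h(C)\<close>. If \<open>A\<close> and \<open>C\<close> do not commute, then \<open>1, A, C\<close> are linearly
  independent, and comparing coefficients shows that \<open>\<alpha> / \<beta>\<close> depends only on the spectra of \<open>A\<close> and
  \<open>C\<close>, not on the angle between their eigenbases, unless \<open>h\<close> is linear. Varying the angle changes
  \<open>k + k'\<close> but not \<open>k k'\<close>, so \<open>\<alpha> / \<beta> = \<Phi> (k k')\<close>. Varying the spectra shows that \<open>\<Phi>\<close> is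
  multiplicative, which leaves only \<open>\<Phi> x = 1\<close>, \<open>\<Phi> x = x\<close> and \<open>\<Phi> x = sqrt x\<close>: the arithmetic, the
  harmonic and the geometric mean. In the last case \<open>h\<close> is linear, and if \<open>h\<close> is linear for every \<open>t\<close>,
  then \<open>f\<close> is the square root and \<open>g\<close> a multiple of the square; an explicit triple of two-by-two
  matrices refutes associativity. Operator monotonicity of \<open>f\<close> serves only to make \<open>f\<close> strictly
  increasing.
\<close>

section \<open>Operators on a complex Hilbert space\<close>

text \<open>A scalar commutes with everything, so with a scalar in the middle each inner product is
  a function of one operator, and associativity compares two means of non-commuting pairs. Where the
  intercepts of \<open>h t\<close> vanish, this comparison degenerates to 0 = 0; hence the argument
  starts from a chord of some \<open>h t\<close> with nonzero intercept and treats the absence of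
  such a chord separately. The space may be infinite-dimensional, so two-by-two matrices enter as
  blocks over a rank-two projection \<open>P\<close>; there a quadratic equation turns the
  functional calculus into linear interpolation. Since \<open>fcalc\<close> is a definite
  description over all approximating polynomials, it must first be shown to denote something; this
  rests on the norm of p(A) being attained by |p| on the spectrum. Operator monotonicity is given on
  \<open>'b\<close> and associativity on \<open>'a\<close>, where dimension two is allowed; only
  scalar facts about \<open>f\<close>, continuity and strict monotonicity, are carried from one
  space to the other.\<close>

instance chilbert \<subseteq> banach ..

lemma norm_imult [simp]: "norm (imult x) = norm x"
  by (simp add: norm_eq_sqrt_inner inner_imult)

lemma bounded_linear_imult: "bounded_linear imult"
  by (rule bounded_linear_intro[where K = 1]) (simp_all add: imult_add imult_scaleR)

lemmas imult_simps [simp] =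
  linear_0[OF bounded_linear.linear[OF bounded_linear_imult]]
  linear_neg[OF bounded_linear.linear[OF bounded_linear_imult]]
  linear_diff[OF bounded_linear.linear[OF bounded_linear_imult]]
  imult_add imult_scaleR imult_imult inner_imult

lemma inner_imult_left: "inner (imult x) y = - inner x (imult y)"
  using inner_imult[of x "imult y"] by simp

lemma inner_imult_self [simp]: "inner x (imult x) = 0"
  using inner_imult_left[of x x] by (simp add: inner_commute)

lemma BH_I: fixes A :: "'a::chilbert \<Rightarrow>\<^sub>L 'a" shows "(\<And>x. A (imult x) = imult (A x)) \<Longrightarrow> A \<in> BH"
  by (simp add: BH_def)

lemma BH_D: "A \<in> BH \<Longrightarrow> A (imult x) = imult (A x)"
  by (simp add: BH_def)

lemma BH_closed [intro, simp]:
  "id_blinfun \<in> BH" "0 \<in> BH"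
  "A \<in> BH \<Longrightarrow> B \<in> BH \<Longrightarrow> A o\<^sub>L B \<in> BH"
  "A \<in> BH \<Longrightarrow> B \<in> BH \<Longrightarrow> A + B \<in> BH"
  "A \<in> BH \<Longrightarrow> B \<in> BH \<Longrightarrow> A - B \<in> BH"
  "A \<in> BH \<Longrightarrow> r *\<^sub>R A \<in> BH"
  by (auto simp: BH_def blinfun.bilinear_simps)

lemmas compose_simps =
  bounded_bilinear.add_left[OF bounded_bilinear_blinfun_compose]
  bounded_bilinear.add_right[OF bounded_bilinear_blinfun_compose]
  bounded_bilinear.diff_left[OF bounded_bilinear_blinfun_compose]
  bounded_bilinear.diff_right[OF bounded_bilinear_blinfun_compose]
  bounded_bilinear.scaleR_left[OF bounded_bilinear_blinfun_compose]
  bounded_bilinear.scaleR_right[OF bounded_bilinear_blinfun_compose]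
  bounded_bilinear.minus_left[OF bounded_bilinear_blinfun_compose]
  bounded_bilinear.minus_right[OF bounded_bilinear_blinfun_compose]
  bounded_bilinear.sum_left[OF bounded_bilinear_blinfun_compose]
  bounded_bilinear.sum_right[OF bounded_bilinear_blinfun_compose]

lemma compose_assoc: "(A o\<^sub>L B) o\<^sub>L C = A o\<^sub>L (B o\<^sub>L C)"
  by (rule blinfun_eqI) simp

lemma compose_id [simp]: "A o\<^sub>L id_blinfun = A" "id_blinfun o\<^sub>L A = A"
  by (auto intro: blinfun_eqI)

lemma tendsto_compose [tendsto_intros]:
  "(X \<longlongrightarrow> A) F \<Longrightarrow> (Y \<longlongrightarrow> B) F \<Longrightarrow> ((\<lambda>n. X n o\<^sub>L Y n) \<longlongrightarrow> A o\<^sub>L B) F"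
  by (rule bounded_bilinear.tendsto[OF bounded_bilinear_blinfun_compose])

lemma tendsto_blinfun_at:
  fixes X :: "'c \<Rightarrow> 'a::real_normed_vector \<Rightarrow>\<^sub>L 'b::real_normed_vector"
  shows "(X \<longlongrightarrow> A) F \<Longrightarrow> ((\<lambda>n. X n x) \<longlongrightarrow> A x) F"
  by (rule bounded_linear.tendsto[OF blinfun.bounded_linear_left])

section \<open>Self-adjoint and positive operators\<close>

definition selfadj :: "('a::chilbert \<Rightarrow>\<^sub>L 'a) \<Rightarrow> bool" where
  "selfadj A \<longleftrightarrow> A \<in> BH \<and> (\<forall>x y. inner (A x) y = inner x (A y))"

lemma selfadj_BH: "selfadj A \<Longrightarrow> A \<in> BH"
  by (simp add: selfadj_def)

lemma selfadj_inner: "selfadj A \<Longrightarrow> inner (A x) y = inner x (A y)"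
  by (simp add: selfadj_def)

lemma selfadj_closed [intro, simp]:
  "selfadj id_blinfun" "selfadj 0"
  "selfadj A \<Longrightarrow> selfadj B \<Longrightarrow> selfadj (A + B)"
  "selfadj A \<Longrightarrow> selfadj B \<Longrightarrow> selfadj (A - B)"
  "selfadj A \<Longrightarrow> selfadj (r *\<^sub>R A)"
  "selfadj A \<Longrightarrow> selfadj B \<Longrightarrow> selfadj (A o\<^sub>L B o\<^sub>L A)"
  by (auto simp: selfadj_def blinfun.bilinear_simps inner_simps)

lemma selfadj_compose: "selfadj A \<Longrightarrow> selfadj B \<Longrightarrow> A o\<^sub>L B = B o\<^sub>L A \<Longrightarrow> selfadj (A o\<^sub>L B)"
  unfolding selfadj_def by (metis BH_closed(3) blinfun_apply_blinfun_compose)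

text \<open>Polarization over the complex numbers: a quadratic form that is real at
  \<open>x\<close>, at \<open>- imult y\<close> and at their sum has symmetric cross terms.\<close>

lemma op_positive_iff: "op_positive A \<longleftrightarrow> selfadj A \<and> (\<forall>x. 0 \<le> inner (A x) x)"
proof
  assume A: "op_positive A"
  then have BH: "A \<in> BH" and im: "\<And>x. inner (A x) (imult x) = 0" and re: "\<And>x. 0 \<le> inner (A x) x"
    by (auto simp: op_positive_def cinner_def)
  have "inner (A x) y = inner x (A y)" for x y
  proof -
    let ?z = "- imult y"
    have "inner (A (x + ?z)) (imult (x + ?z)) = 0" by (rule im)
    then have "inner (A x) (imult ?z) + inner (A ?z) (imult x) = 0"
      using im[of x] im[of ?z] by (simp add: blinfun.bilinear_simps inner_simps)
    then show ?thesis
      by (simp add: blinfun.bilinear_simps BH_D[OF BH] inner_simps inner_commute)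
  qed
  then show "selfadj A \<and> (\<forall>x. 0 \<le> inner (A x) x)"
    using BH re by (simp add: selfadj_def)
next
  assume *: "selfadj A \<and> (\<forall>x. 0 \<le> inner (A x) x)"
  then have BH: "A \<in> BH" by (simp add: selfadj_BH)
  have "inner (A x) (imult x) = 0" for x
  proof -
    have "inner (A x) (imult x) = inner x (imult (A x))"
      using * by (simp add: selfadj_inner BH_D[OF BH])
    also have "\<dots> = - inner (A x) (imult x)"
      using inner_imult_left[of "A x" x] by (simp add: inner_commute)
    finally show ?thesis by simp
  qed
  then show "op_positive A"
    using * BH by (simp add: op_positive_def cinner_def)
qed

section \<open>Criteria for invertibility\<close>

lemma op_invertibleI:
  "A \<in> BH \<Longrightarrow> B \<in> BH \<Longrightarrow> A o\<^sub>L B = id_blinfun \<Longrightarrow> B o\<^sub>L A = id_blinfun \<Longrightarrow> op_invertible A"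
  unfolding op_invertible_def by blast

lemma op_invertible_compose:
  assumes "op_invertible A" "op_invertible B"
  shows "op_invertible (A o\<^sub>L B)"
proof -
  obtain A' B' where *: "A' \<in> BH" "A o\<^sub>L A' = id_blinfun" "A' o\<^sub>L A = id_blinfun"
    "B' \<in> BH" "B o\<^sub>L B' = id_blinfun" "B' o\<^sub>L B = id_blinfun"
    using assms unfolding op_invertible_def by blast
  have "(A o\<^sub>L B) o\<^sub>L (B' o\<^sub>L A') = A o\<^sub>L (B o\<^sub>L B') o\<^sub>L A'"
    "(B' o\<^sub>L A') o\<^sub>L (A o\<^sub>L B) = B' o\<^sub>L (A' o\<^sub>L A) o\<^sub>L B"
    by (simp_all only: compose_assoc)
  then show ?thesis
    using * assms by (intro op_invertibleI[of _ "B' o\<^sub>L A'"]) (auto simp: op_invertible_def)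
qed

lemma op_inv_eq:
  assumes "A o\<^sub>L B = id_blinfun" "B o\<^sub>L A = id_blinfun"
  shows "op_inv A = B"
  unfolding op_inv_def
proof (rule the_equality)
  fix C assume C: "A o\<^sub>L C = id_blinfun \<and> C o\<^sub>L A = id_blinfun"
  have "C = C o\<^sub>L (A o\<^sub>L B)" using assms by simp
  also have "\<dots> = B" using C by (simp add: compose_assoc[symmetric])
  finally show "C = B" .
qed (use assms in simp)

text \<open>Solving \<open>A x = y\<close> is the fixed-point problem of the contraction sending x
  to \<open>x - A x + y\<close>. Uniqueness of its solution makes the inverse real linear and
  commuting with \<open>imult\<close>.\<close>

lemma near_identity_invertible:
  fixes A :: "'a::chilbert \<Rightarrow>\<^sub>L 'a"
  assumes BH: "A \<in> BH" and k: "0 \<le> k" "k < 1" and le: "\<And>x. norm (x - A x) \<le> k * norm x"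
  shows "op_invertible A"
proof -
  have ex: "\<exists>!x. A x = y" for y
  proof -
    have "dist (x - A x + y) (x' - A x' + y) \<le> k * dist x x'" for x x'
      using le[of "x - x'"] by (simp add: dist_norm blinfun.bilinear_simps algebra_simps)
    then have "\<exists>!x. x - A x + y = x"
      using banach_fix_type[OF k, of "\<lambda>x. x - A x + y"] by blast
    then have "\<exists>!x. y = A x" by (simp add: algebra_simps)
    then show ?thesis by metis
  qed
  define B where "B y = (THE x. A x = y)" for y
  have AB: "A (B y) = y" for y
    unfolding B_def by (rule theI') (rule ex)
  have BA: "A x = y \<Longrightarrow> B y = x" for x y
    using ex AB by blast
  have nb: "norm (B y) \<le> norm y * (1 / (1 - k))" for y
  proof -
    have "norm (B y) \<le> norm (B y - A (B y)) + norm (A (B y))"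
      using norm_triangle_ineq[of "B y - A (B y)" "A (B y)"] by simp
    then have "norm (B y) * (1 - k) \<le> norm y"
      using le[of "B y"] by (simp add: AB algebra_simps)
    then show ?thesis using k by (simp add: field_simps)
  qed
  have bl: "bounded_linear B"
    by (rule bounded_linear_intro[OF _ _ nb]) (rule BA, simp add: blinfun.bilinear_simps AB)+
  have "B (imult y) = imult (B y)" for y
    by (rule BA) (simp add: BH_D[OF BH] AB)
  then show ?thesis
    by (intro op_invertibleI[OF BH, of "Blinfun B"] BH_I blinfun_eqI)
      (auto simp: bounded_linear_Blinfun_apply[OF bl] AB intro: BA)
qed

lemma op_invertible_scaleR:
  fixes A :: "'a::chilbert \<Rightarrow>\<^sub>L 'a"
  assumes "op_invertible A" "r \<noteq> 0"
  shows "op_invertible (r *\<^sub>R A)"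
proof -
  have "op_invertible (r *\<^sub>R id_blinfun :: 'a \<Rightarrow>\<^sub>L 'a)"
    using assms(2) by (intro op_invertibleI[of _ "(1 / r) *\<^sub>R id_blinfun"]) (auto simp: compose_simps)
  from op_invertible_compose[OF this assms(1)] show ?thesis by (simp add: compose_simps)
qed

text \<open>The Lax-Milgram argument: a small multiple of \<open>A\<close> is close enough to the
  identity, because coercivity makes the term linear in \<open>e\<close> negative in the squared
  norm of x - e A x.\<close>

lemma coercive_invertible:
  fixes A :: "'a::chilbert \<Rightarrow>\<^sub>L 'a"
  assumes BH: "A \<in> BH" and c: "0 < c" and le: "\<And>x. c * (norm x)\<^sup>2 \<le> inner (A x) x"
  shows "op_invertible A"
proof -
  define N where "N = norm A + c"
  \<comment> \<open>This \<open>e\<close> minimises 1 - 2 e c + e^2 N^2, with minimum 1 - e c;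
    adding \<open>c\<close> to the norm in \<open>N\<close> keeps that value nonnegative.\<close>
  define e where "e = c / N\<^sup>2"
  have N: "N > 0" "c \<le> N" "norm A \<le> N" using c by (auto simp: N_def add_nonneg_pos)
  have e: "e > 0" using c N by (simp add: e_def)
  define k where "k = sqrt (1 - e * c)"
  have ec: "e * c \<le> 1" "0 < e * c"
  proof -
    have "c * c \<le> N * N" using N c by (intro mult_mono) auto
    then show "e * c \<le> 1" using N by (simp add: e_def power2_eq_square)
    show "0 < e * c" using e c by simp
  qed
  have "norm (x - (e *\<^sub>R A) x) \<le> k * norm x" for x
  proof (rule power2_le_imp_le)
    have "norm (A x) \<le> N * norm x"
      using norm_blinfun[of A x] N mult_right_mono[of "norm A" N "norm x"] by simp
    then have 1: "(norm (A x))\<^sup>2 \<le> N\<^sup>2 * (norm x)\<^sup>2"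
      using power_mono[of "norm (A x)" "N * norm x" 2] by (simp add: power_mult_distrib)
    have "(norm (x - (e *\<^sub>R A) x))\<^sup>2 = (norm x)\<^sup>2 - 2 * e * inner (A x) x + e\<^sup>2 * (norm (A x))\<^sup>2"
      by (simp only: power2_norm_eq_inner)
        (simp add: blinfun.bilinear_simps inner_simps inner_commute algebra_simps power2_eq_square)
    also have "\<dots> \<le> (norm x)\<^sup>2 - 2 * e * (c * (norm x)\<^sup>2) + e\<^sup>2 * (N\<^sup>2 * (norm x)\<^sup>2)"
      using le[of x] 1 e by (intro add_mono diff_mono mult_left_mono) auto
    also have "e\<^sup>2 * (N\<^sup>2 * (norm x)\<^sup>2) = e * c * (norm x)\<^sup>2"
      using N by (simp add: e_def power2_eq_square field_simps)
    also have "(norm x)\<^sup>2 - 2 * e * (c * (norm x)\<^sup>2) + e * c * (norm x)\<^sup>2 = (k * norm x)\<^sup>2"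
      using ec by (simp add: k_def power_mult_distrib algebra_simps)
    finally show "(norm (x - (e *\<^sub>R A) x))\<^sup>2 \<le> (k * norm x)\<^sup>2" .
  qed (use ec in \<open>simp add: k_def\<close>)
  moreover have "0 \<le> k" "k < 1" using ec by (auto simp: k_def)
  ultimately have "op_invertible (e *\<^sub>R A)"
    using BH by (intro near_identity_invertible[of _ k]) auto
  from op_invertible_scaleR[OF this, of "1 / e"] show ?thesis using e by simp
qed

section \<open>Polynomials of a self-adjoint operator\<close>

lemma op_pow_simps [simp]: "op_pow A 0 = id_blinfun" "op_pow A (Suc n) = A o\<^sub>L op_pow A n"
  by (simp_all add: op_pow_def)

lemma poly_op_altdef:
  assumes "degree p \<le> n"
  shows "poly_op p A = (\<Sum>k\<le>n. coeff p k *\<^sub>R op_pow A k)"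
  unfolding poly_op_def
  by (rule sum.mono_neutral_left) (use assms in \<open>auto simp: coeff_eq_0 not_le\<close>)

lemma poly_op_0 [simp]: "poly_op 0 A = 0"
  by (simp add: poly_op_def)

lemma poly_op_pCons [simp]: "poly_op (pCons a p) A = a *\<^sub>R id_blinfun + (A o\<^sub>L poly_op p A)"
proof -
  have "poly_op (pCons a p) A = (\<Sum>k\<le>Suc (degree p). coeff (pCons a p) k *\<^sub>R op_pow A k)"
    by (rule poly_op_altdef) (simp add: degree_pCons_le)
  also have "\<dots> = a *\<^sub>R id_blinfun + (A o\<^sub>L poly_op p A)"
    by (subst sum.atMost_Suc_shift) (simp add: compose_simps poly_op_def)
  finally show ?thesis .
qed

lemma poly_op_add: "poly_op (p + q) A = poly_op p A + poly_op q A"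
proof -
  let ?n = "max (degree p) (degree q)"
  have "poly_op (p + q) A = (\<Sum>k\<le>?n. coeff (p + q) k *\<^sub>R op_pow A k)"
    by (rule poly_op_altdef) (simp add: degree_add_le)
  then show ?thesis
    by (simp add: poly_op_altdef[of _ ?n] sum.distrib scaleR_left_distrib)
qed

lemma poly_op_smult: "poly_op (smult c p) A = c *\<^sub>R poly_op p A"
  by (induction p) (simp_all add: algebra_simps compose_simps)

lemma poly_op_diff: "poly_op (p - q) A = poly_op p A - poly_op q A"
  using poly_op_add[of p "smult (-1) q" A] poly_op_smult[of "-1" q A] by simp

lemma poly_op_mult: "poly_op (p * q) A = poly_op p A o\<^sub>L poly_op q A"
  by (induction p) (simp_all add: poly_op_add poly_op_smult compose_simps compose_assoc)

lemma poly_op_commute: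
  assumes "A o\<^sub>L P = P o\<^sub>L A"
  shows "poly_op p A o\<^sub>L P = P o\<^sub>L poly_op p A"
proof (induction p)
  case (pCons a p)
  have "A o\<^sub>L poly_op p A o\<^sub>L P = A o\<^sub>L P o\<^sub>L poly_op p A"
    by (simp add: compose_assoc pCons)
  then show ?case by (simp add: compose_simps assms compose_assoc)
qed simp

lemma poly_op_eigenvector:
  fixes A :: "'a::chilbert \<Rightarrow>\<^sub>L 'a"
  shows "A x = l *\<^sub>R x \<Longrightarrow> poly_op p A x = poly p l *\<^sub>R x"
  by (induction p) (simp_all add: blinfun.bilinear_simps algebra_simps)

lemma selfadj_poly_op: "selfadj A \<Longrightarrow> selfadj (poly_op p A)"
proof (induction p)
  case (pCons a p)
  have "A o\<^sub>L poly_op p A = poly_op p A o\<^sub>L A" by (simp add: poly_op_commute)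
  then show ?case using pCons by (simp add: selfadj_compose)
qed simp

text \<open>The operator is (A - a)^2 + b^2, which is coercive with constant b^2.\<close>

lemma irreducible_quadratic_invertible:
  fixes A :: "'a::chilbert \<Rightarrow>\<^sub>L 'a"
  assumes A: "selfadj A" and b: "b \<noteq> 0"
  shows "op_invertible (poly_op [:a\<^sup>2 + b\<^sup>2, - 2 * a, 1:] A)"
proof (rule coercive_invertible)
  let ?P = "poly_op [:a\<^sup>2 + b\<^sup>2, - 2 * a, 1:] A"
  show "?P \<in> BH" using selfadj_poly_op[OF A] by (rule selfadj_BH)
  show "0 < b\<^sup>2" using b by simp
  fix x
  have "inner (?P x) x = inner (A (A x)) x - 2 * a * inner (A x) x + (a\<^sup>2 + b\<^sup>2) * inner x x"
    by (simp add: blinfun.bilinear_simps inner_simps algebra_simps)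
  also have "inner (A (A x)) x = inner (A x) (A x)" by (rule selfadj_inner[OF A])
  also have "inner (A x) (A x) - 2 * a * inner (A x) x + (a\<^sup>2 + b\<^sup>2) * inner x x
     = (norm (A x - a *\<^sub>R x))\<^sup>2 + b\<^sup>2 * (norm x)\<^sup>2"
    by (simp only: power2_norm_eq_inner) (simp add: inner_simps inner_commute power2_eq_square algebra_simps)
  finally show "b\<^sup>2 * (norm x)\<^sup>2 \<le> inner (?P x) x" by simp
qed

lemma poly_map_poly_complex_of_real: "poly (map_poly of_real q) (complex_of_real x) = of_real (poly q x)"
  by (induction q) (simp_all add: map_poly_pCons)

text \<open>The divisor has the roots z and its conjugate; a real remainder of degree below two
  cannot vanish at a nonreal point unless it is zero.\<close>

lemma nonreal_root_factor:
  fixes q :: "real poly"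
  assumes root: "poly (map_poly of_real q) z = 0" and z: "Im z \<noteq> 0"
  shows "[:(Re z)\<^sup>2 + (Im z)\<^sup>2, - 2 * Re z, 1:] dvd q"
proof -
  let ?d = "[:(Re z)\<^sup>2 + (Im z)\<^sup>2, - 2 * Re z, 1:]"
  let ?c = "map_poly complex_of_real"
  have hom: "?c (u + v) = ?c u + ?c v" "?c (u * v) = ?c u * ?c v" for u v :: "real poly"
    by (rule poly_eqI, simp add: coeff_map_poly coeff_mult)+
  have dz: "poly (?c ?d) z = 0"
    by (simp add: map_poly_pCons complex_eq_iff power2_eq_square algebra_simps)
  define r where "r = q mod ?d"
  have "q = q div ?d * ?d + r" unfolding r_def by (rule div_mult_mod_eq[symmetric])
  then have "?c q = ?c (q div ?d) * ?c ?d + ?c r" by (metis hom)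
  then have rz: "poly (?c r) z = 0" using root dz by simp
  have "degree r < 2"
    using degree_mod_less'[of ?d q] by (cases "r = 0") (auto simp: r_def)
  then have "r = [:coeff r 0, coeff r 1:]"
    by (intro poly_eqI) (auto simp: coeff_pCons coeff_eq_0 split: nat.splits)
  then obtain r0 r1 where r: "r = [:r0, r1:]" by blast
  have "r1 = 0 \<and> r0 = 0"
    using rz z by (auto simp: r map_poly_pCons complex_eq_iff)
  then have "q mod ?d = 0" using r unfolding r_def by simp
  then show ?thesis by (simp only: mod_eq_0_iff_dvd)
qed

text \<open>One half of the spectral mapping theorem. \<open>op_spec\<close> records only real
  points, so the factorisation is the real one: a linear factor that is not invertible yields a
  spectral point, and quadratic factors with nonreal roots are always invertible.\<close>

lemma poly_op_noninvertible_root: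
  fixes A :: "'a::chilbert \<Rightarrow>\<^sub>L 'a"
  assumes A: "selfadj A" and "q \<noteq> 0" "\<not> op_invertible (poly_op q A)"
  shows "\<exists>r\<in>op_spec A. poly q r = 0"
  using assms(2,3)
proof (induction "degree q" arbitrary: q rule: less_induct)
  case less
  show ?case
  proof (cases "degree q = 0")
    case True
    then obtain c where c: "q = [:c:]" by (rule degree_eq_zeroE)
    then have "c \<noteq> 0" using less by simp
    then have "op_invertible (c *\<^sub>R id_blinfun :: 'a \<Rightarrow>\<^sub>L 'a)"
      by (intro op_invertibleI[of _ "(1 / c) *\<^sub>R id_blinfun"]) (auto simp: compose_simps)
    then show ?thesis using less.prems c by simp
  next
    case False
    let ?c = "map_poly complex_of_real"
    have "degree (?c q) = degree q" by (simp add: degree_map_poly)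
    then have "\<not> constant (poly (?c q))" using False by (simp add: constant_degree)
    then obtain z where z: "poly (?c q) z = 0" using fundamental_theorem_of_algebra by blast
    have step: ?thesis
      if q: "q = d * s" and d: "degree d > 0" and nr: "op_invertible (poly_op d A) \<or> (\<exists>r\<in>op_spec A. poly d r = 0)"
      for d s
    proof -
      from nr show ?thesis
      proof
        assume inv: "op_invertible (poly_op d A)"
        have s: "s \<noteq> 0" "d \<noteq> 0" using q less.prems by auto
        have "\<not> op_invertible (poly_op s A)"
          using op_invertible_compose[OF inv] less.prems q by (auto simp: poly_op_mult)
        moreover have "degree s < degree q" using s d q by (simp add: degree_mult_eq)
        ultimately show ?thesis using less.hyps[of s] s q by auto
      qed (auto simp: q)
    qed
    show ?thesis
    proof (cases "Im z = 0")
      case True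
      then have "z = complex_of_real (Re z)" by (simp add: complex_eq_iff)
      then have "poly q (Re z) = 0"
        using z by (metis of_real_eq_0_iff poly_map_poly_complex_of_real)
      then obtain s where s: "q = [:- Re z, 1:] * s" by (auto simp: poly_eq_0_iff_dvd dvd_def)
      have "op_invertible (poly_op [:- Re z, 1:] A) \<or> Re z \<in> op_spec A"
        by (simp add: op_spec_def)
      then show ?thesis by (intro step[OF s]) auto
    next
      case False
      then obtain s where s: "q = [:(Re z)\<^sup>2 + (Im z)\<^sup>2, - 2 * Re z, 1:] * s"
        using nonreal_root_factor[OF z] by (auto simp: dvd_def)
      show ?thesis
        by (rule step[OF s]) (use irreducible_quadratic_invertible[OF A False] in auto)
    qed
  qed
qed

text \<open>The squared norm is a spectral value of the square: an inverse of the difference would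
  bound that difference below on every vector, and then the norm of \<open>T x\<close> would stay a
  fixed factor below \<open>norm T * norm x\<close>.\<close>

lemma norm_square_noninvertible:
  fixes T :: "'a::chilbert \<Rightarrow>\<^sub>L 'a"
  assumes T: "selfadj T" and ne: "\<exists>x::'a. x \<noteq> 0"
  shows "\<not> op_invertible ((T o\<^sub>L T) - (norm T)\<^sup>2 *\<^sub>R id_blinfun)"
proof
  let ?D = "(T o\<^sub>L T) - (norm T)\<^sup>2 *\<^sub>R id_blinfun"
  assume "op_invertible ?D"
  then obtain B where B: "B o\<^sub>L ?D = id_blinfun" unfolding op_invertible_def by blast
  then have BD: "B (?D x) = x" for x by (metis blinfun_apply_blinfun_compose blinfun_apply_id_blinfun)
  define M where "M = norm T"
  define K where "K = norm B + 1"
  have K: "K > 0" by (simp add: K_def add_nonneg_pos)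
  have M0: "M > 0"
  proof (rule ccontr)
    assume "\<not> M > 0"
    then have "?D = 0" by (simp add: M_def)
    then show False using BD ne by (metis blinfun.zero_left blinfun.zero_right)
  qed
  have est: "(norm (T x))\<^sup>2 \<le> (M\<^sup>2 - 1 / (K\<^sup>2 * M\<^sup>2)) * (norm x)\<^sup>2" for x
  proof -
    have "norm x \<le> norm B * norm (?D x)" using norm_blinfun[of B "?D x"] BD by simp
    also have "\<dots> \<le> K * norm (?D x)" by (simp add: K_def algebra_simps)
    finally have 1: "(norm x)\<^sup>2 \<le> K\<^sup>2 * (norm (?D x))\<^sup>2"
      using power_mono[of "norm x" "K * norm (?D x)" 2] by (simp add: power_mult_distrib)
    have 2: "(norm (T (T x)))\<^sup>2 \<le> M\<^sup>2 * (norm (T x))\<^sup>2"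
      using power_mono[OF norm_blinfun[of T "T x"], of 2] by (simp add: power_mult_distrib M_def)
    have "inner (T (T x)) x = (norm (T x))\<^sup>2"
      by (simp add: selfadj_inner[OF T] power2_norm_eq_inner)
    then have "(norm (?D x))\<^sup>2 = (norm (T (T x)))\<^sup>2 - 2 * M\<^sup>2 * (norm (T x))\<^sup>2 + M ^ 4 * (norm x)\<^sup>2"
      by (simp only: power2_norm_eq_inner)
        (simp add: blinfun.bilinear_simps inner_simps inner_commute M_def
          power4_eq_xxxx power2_eq_square algebra_simps)
    then have "(norm (?D x))\<^sup>2 \<le> M ^ 4 * (norm x)\<^sup>2 - M\<^sup>2 * (norm (T x))\<^sup>2" using 2 by simp
    then have "(norm x)\<^sup>2 \<le> K\<^sup>2 * (M ^ 4 * (norm x)\<^sup>2 - M\<^sup>2 * (norm (T x))\<^sup>2)"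
      using 1 by (meson mult_left_mono order_trans zero_le_power2)
    then show ?thesis using K M0
      by (simp add: field_simps power4_eq_xxxx power2_eq_square)
  qed
  define c where "c = M\<^sup>2 - 1 / (K\<^sup>2 * M\<^sup>2)"
  have cM: "c < M\<^sup>2" using K M0 by (simp add: c_def)
  have "norm (T x) \<le> sqrt (max c 0) * norm x" for x
  proof (rule power2_le_imp_le)
    have "(norm (T x))\<^sup>2 \<le> c * (norm x)\<^sup>2" using est by (simp add: c_def)
    also have "\<dots> \<le> max c 0 * (norm x)\<^sup>2" by (intro mult_right_mono) auto
    finally show "(norm (T x))\<^sup>2 \<le> (sqrt (max c 0) * norm x)\<^sup>2" by (simp add: power_mult_distrib)
  qed simp
  then have "norm T \<le> sqrt (max c 0)" by (intro norm_blinfun_bound) auto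
  then have "M \<le> sqrt (max c 0)" by (simp add: M_def)
  then have "M\<^sup>2 \<le> max c 0" by (metis M0 less_eq_real_def max.cobounded2 power_mono real_sqrt_pow2)
  moreover have "0 < M\<^sup>2" using M0 by simp
  ultimately show False using cM by linarith
qed

text \<open>The squared norm of p(A) is a spectral value of p(A)^2, hence the value of p^2 at a
  point of the spectrum of \<open>A\<close>. This lets uniform approximation on the spectrum control
  operator norms.\<close>

lemma norm_poly_op_attained:
  fixes A :: "'a::chilbert \<Rightarrow>\<^sub>L 'a"
  assumes A: "selfadj A" and ne: "poly_op p A \<noteq> 0"
  shows "\<exists>r\<in>op_spec A. \<bar>poly p r\<bar> = norm (poly_op p A)"
proof -
  have nt: "\<exists>x::'a. x \<noteq> 0" using ne by (metis blinfun.zero_right blinfun_eqI)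
  have *: "\<exists>r\<in>op_spec A. poly (p * p - [:(norm (poly_op p A))\<^sup>2:]) r = 0"
    if "p * p - [:(norm (poly_op p A))\<^sup>2:] \<noteq> 0" for p
    using norm_square_noninvertible[OF selfadj_poly_op[OF A] nt, of p]
    by (intro poly_op_noninvertible_root[OF A that]) (simp add: poly_op_diff poly_op_mult)
  \<comment> \<open>The polynomial x shows that the spectrum is nonempty, which is all that is left
    to know when p^2 is constant.\<close>
  obtain r0 where r0: "r0 \<in> op_spec A"
    using *[of "[:0, 1:]"] by auto
  have "\<exists>r\<in>op_spec A. poly (p * p - [:(norm (poly_op p A))\<^sup>2:]) r = 0"
    by (cases "p * p - [:(norm (poly_op p A))\<^sup>2:] = 0") (use r0 * in auto)
  then obtain r where "r \<in> op_spec A" "(poly p r)\<^sup>2 = (norm (poly_op p A))\<^sup>2"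
    by (auto simp: power2_eq_square)
  then show ?thesis
    by (metis abs_norm_cancel power2_eq_iff abs_minus_cancel)
qed

lemma norm_poly_op_le:
  assumes "selfadj A" "0 \<le> e" "\<And>r. r \<in> op_spec A \<Longrightarrow> \<bar>poly p r\<bar> \<le> e"
  shows "norm (poly_op p A) \<le> e"
  using norm_poly_op_attained[of A p] assms by (cases "poly_op p A = 0") fastforce+

section \<open>Continuous functional calculus of positive definite operators\<close>

lemma PD_I: "selfadj A \<Longrightarrow> (\<And>x. 0 \<le> inner (A x) x) \<Longrightarrow> op_invertible A \<Longrightarrow> A \<in> PD"
  by (simp add: PD_def op_positive_iff)

lemma PD_selfadj: "A \<in> PD \<Longrightarrow> selfadj A"
  by (simp add: PD_def op_positive_iff)

lemma PD_inner_nonneg: "A \<in> PD \<Longrightarrow> 0 \<le> inner (A x) x"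
  by (simp add: PD_def op_positive_iff)

lemma PD_scaleR_id: "0 < t \<Longrightarrow> t *\<^sub>R id_blinfun \<in> PD"
  by (intro PD_I op_invertible_scaleR op_invertibleI[of _ id_blinfun])
    (auto simp: blinfun.bilinear_simps)

text \<open>A function continuous on \<open>{0<..}\<close> may be unbounded near 0, so the spectrum
  has to be caught in a compact interval away from 0. Points near 0 are excluded by factoring A - r
  as A (1 - r B), with B the inverse of A.\<close>

lemma PD_spec_bounds:
  fixes A :: "'a::chilbert \<Rightarrow>\<^sub>L 'a"
  assumes A: "A \<in> PD"
  obtains m where "0 < m" "op_spec A \<subseteq> {m..norm A}"
proof -
  have sa: "selfadj A" using A by (rule PD_selfadj)
  then have BH: "A \<in> BH" by (rule selfadj_BH)
  have inv: "op_invertible A" using A by (simp add: PD_def)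
  then obtain B where B: "B \<in> BH" "A o\<^sub>L B = id_blinfun" unfolding op_invertible_def by blast
  define m where "m = 1 / (norm B + 1)"
  have m: "m > 0" by (simp add: m_def add_nonneg_pos)
  have "op_spec A \<subseteq> {m..norm A}"
  proof
    fix r assume r: "r \<in> op_spec A"
    have "r \<ge> 0"
    proof (rule ccontr)
      assume "\<not> r \<ge> 0"
      then have "op_invertible (A - r *\<^sub>R id_blinfun)"
        using BH PD_inner_nonneg[OF A]
        by (intro coercive_invertible[of _ "- r"])
          (auto simp: blinfun.bilinear_simps inner_simps power2_norm_eq_inner)
      then show False using r by (simp add: op_spec_def)
    qed
    have "m \<le> r"
    proof (rule ccontr)
      assume "\<not> m \<le> r"
      then have "r * (norm B + 1) < 1"
        by (simp add: m_def not_le pos_less_divide_eq add_nonneg_pos)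
      then have rB: "r * norm B < 1" using \<open>r \<ge> 0\<close> by (simp add: algebra_simps)
      have "op_invertible (id_blinfun - r *\<^sub>R B)"
      proof (rule near_identity_invertible[OF _ _ rB])
        show "norm (x - (id_blinfun - r *\<^sub>R B) x) \<le> r * norm B * norm x" for x
          using norm_blinfun[of B x] \<open>r \<ge> 0\<close> mult_left_mono[of "norm (B x)" "norm B * norm x" r]
          by (simp add: blinfun.bilinear_simps)
      qed (use B \<open>r \<ge> 0\<close> in auto)
      then have "op_invertible (A o\<^sub>L (id_blinfun - r *\<^sub>R B))"
        by (rule op_invertible_compose[OF inv])
      then show False using r B by (simp add: compose_simps op_spec_def)
    qed
    moreover have "r \<le> norm A"
    proof (rule ccontr)
      assume r': "\<not> r \<le> norm A"
      have "op_invertible (r *\<^sub>R id_blinfun - A)"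
      proof (rule coercive_invertible)
        show "0 < r - norm A" using r' by simp
        fix x
        have "inner (A x) x \<le> norm (A x) * norm x" by (rule norm_cauchy_schwarz)
        also have "\<dots> \<le> norm A * norm x * norm x" by (intro mult_right_mono norm_blinfun) simp
        finally show "(r - norm A) * (norm x)\<^sup>2 \<le> inner ((r *\<^sub>R id_blinfun - A) x) x"
          by (simp add: blinfun.bilinear_simps inner_simps power2_norm_eq_inner[symmetric]
              power2_eq_square algebra_simps)
      qed (use BH in auto)
      from op_invertible_scaleR[OF this, of "-1"] show False using r by (simp add: op_spec_def)
    qed
    ultimately show "r \<in> {m..norm A}" by simp
  qed
  with m show thesis by (rule that)
qed

lemma PD_spec_pos: "A \<in> PD \<Longrightarrow> r \<in> op_spec A \<Longrightarrow> 0 < r"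
  using PD_spec_bounds[of A] by (metis atLeastAtMost_iff in_mono less_le_trans)

lemma weierstrass_poly:
  assumes "compact S" "continuous_on S (h :: real \<Rightarrow> real)" "0 < e"
  obtains p where "\<And>t. t \<in> S \<Longrightarrow> \<bar>poly p t - h t\<bar> < e"
proof -
  obtain q where q: "real_polynomial_function q" "\<And>t. t \<in> S \<Longrightarrow> \<bar>h t - q t\<bar> < e"
    using Stone_Weierstrass_real_polynomial_function[OF assms] by blast
  obtain a n where a: "q = (\<lambda>x. \<Sum>i\<le>n. a i * x ^ i)"
    using q(1) unfolding real_polynomial_function_iff_sum by blast
  have "poly (\<Sum>i\<le>n. monom (a i) i) t = q t" for t
    by (simp add: a poly_sum poly_monom)
  then show thesis using q(2) by (intro that[of "\<Sum>i\<le>n. monom (a i) i"]) (simp add: abs_minus_commute)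
qed

lemma PD_poly_approx:
  assumes A: "A \<in> PD" and h: "continuous_on {0<..} h"
  obtains p where "uniform_limit (op_spec A) (\<lambda>n t. poly (p n) t) h sequentially"
proof -
  obtain m where m: "0 < m" "op_spec A \<subseteq> {m..norm A}" using PD_spec_bounds[OF A] .
  have "continuous_on {m..norm A} h"
    by (rule continuous_on_subset[OF h]) (use m in auto)
  then have "\<exists>p. \<forall>t\<in>{m..norm A}. \<bar>poly p t - h t\<bar> < inverse (real (Suc n))" for n
    using weierstrass_poly[of "{m..norm A}" h "inverse (real (Suc n))"]
    by (metis compact_Icc inverse_positive_iff_positive of_nat_0_less_iff zero_less_Suc)
  then obtain p where p: "\<And>n t. t \<in> {m..norm A} \<Longrightarrow> \<bar>poly (p n) t - h t\<bar> < inverse (real (Suc n))"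
    by metis
  have "uniform_limit (op_spec A) (\<lambda>n t. poly (p n) t) h sequentially"
  proof (rule uniform_limitI)
    fix e :: real assume "0 < e"
    then have "\<forall>\<^sub>F n in sequentially. inverse (real (Suc n)) < e"
      using LIMSEQ_inverse_real_of_nat by (rule order_tendstoD(2)[rotated])
    then show "\<forall>\<^sub>F n in sequentially. \<forall>t\<in>op_spec A. dist (poly (p n) t) (h t) < e"
      by eventually_elim (use p m in \<open>force simp: dist_real_def intro: less_trans\<close>)
  qed
  then show thesis by (rule that)
qed

lemma PD_bounded_image:
  assumes A: "A \<in> PD" and h: "continuous_on {0<..} (h :: real \<Rightarrow> real)"
  shows "bounded (h ` op_spec A)"
proof -
  obtain m where m: "0 < m" "op_spec A \<subseteq> {m..norm A}" using PD_spec_bounds[OF A] .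
  have "continuous_on {m..norm A} h"
    by (rule continuous_on_subset[OF h]) (use m in auto)
  then have "bounded (h ` {m..norm A})"
    by (intro compact_imp_bounded compact_continuous_image) auto
  then show ?thesis using m by (meson bounded_subset image_mono)
qed

text \<open>Makes the description in \<open>fcalc\<close> well defined. Two approximating sequences
  come close on the spectrum, so their operators come close in norm; equal sequences give the Cauchy
  property, different ones the independence of the choice.\<close>

lemma fcalc_tendsto:
  fixes A :: "'a::chilbert \<Rightarrow>\<^sub>L 'a"
  assumes A: "A \<in> PD" and h: "continuous_on {0<..} h"
    and p: "uniform_limit (op_spec A) (\<lambda>n t. poly (p n) t) h sequentially"
  shows "(\<lambda>n. poly_op (p n) A) \<longlonglongrightarrow> fcalc h A"
proof -
  have sa: "selfadj A" using A by (rule PD_selfadj)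
  have close: "\<exists>N. \<forall>n\<ge>N. \<forall>k\<ge>N. dist (poly_op (q n) A) (poly_op (q' k) A) \<le> e"
    if q: "uniform_limit (op_spec A) (\<lambda>n t. poly (q n) t) h sequentially"
      and q': "uniform_limit (op_spec A) (\<lambda>n t. poly (q' n) t) h sequentially"
      and e: "0 < e" for q q' e
  proof -
    have "\<forall>\<^sub>F n in sequentially. \<forall>t\<in>op_spec A. dist (poly (q n) t) (h t) < e / 2"
      "\<forall>\<^sub>F n in sequentially. \<forall>t\<in>op_spec A. dist (poly (q' n) t) (h t) < e / 2"
      using e by (auto intro!: uniform_limitD[OF q] uniform_limitD[OF q'] simp del: less_divide_eq_numeral1)
    then have "\<forall>\<^sub>F n in sequentially. \<forall>t\<in>op_spec A. dist (poly (q n) t) (h t) < e / 2 \<and> dist (poly (q' n) t) (h t) < e / 2"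
      by eventually_elim auto
    then obtain N where N: "\<And>n t. n \<ge> N \<Longrightarrow> t \<in> op_spec A \<Longrightarrow>
       dist (poly (q n) t) (h t) < e / 2 \<and> dist (poly (q' n) t) (h t) < e / 2"
      unfolding eventually_sequentially by blast
    have "dist (poly_op (q n) A) (poly_op (q' k) A) \<le> e" if "n \<ge> N" "k \<ge> N" for n k
    proof -
      have "\<bar>poly (q n - q' k) t\<bar> \<le> e" if "t \<in> op_spec A" for t
        using N[OF \<open>n \<ge> N\<close> that] N[OF \<open>k \<ge> N\<close> that]
        unfolding dist_real_def poly_diff by argo
      then have "norm (poly_op (q n - q' k) A) \<le> e"
        using e by (intro norm_poly_op_le[OF sa]) auto
      then show ?thesis by (simp add: poly_op_diff dist_norm)
    qed
    then show ?thesis by blast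
  qed
  obtain q where q: "uniform_limit (op_spec A) (\<lambda>n t. poly (q n) t) h sequentially"
    using PD_poly_approx[OF A h] .
  have "Cauchy (\<lambda>n. poly_op (q n) A)"
  proof (rule metric_CauchyI)
    fix e :: real assume "0 < e"
    then have "0 < e / 2" "e / 2 < e" by auto
    then show "\<exists>M. \<forall>m\<ge>M. \<forall>n\<ge>M. dist (poly_op (q m) A) (poly_op (q n) A) < e"
      using close[OF q q, of "e / 2"] by (meson le_less_trans)
  qed
  then obtain T where T: "(\<lambda>n. poly_op (q n) A) \<longlonglongrightarrow> T"
    by (auto simp: Cauchy_convergent_iff convergent_def)
  have all: "(\<lambda>n. poly_op (q' n) A) \<longlonglongrightarrow> T"
    if q': "uniform_limit (op_spec A) (\<lambda>n t. poly (q' n) t) h sequentially" for q'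
  proof -
    have "(\<lambda>n. poly_op (q' n) A - poly_op (q n) A) \<longlonglongrightarrow> 0"
    proof (rule metric_LIMSEQ_I)
      fix e :: real assume "0 < e"
      then obtain N where "\<forall>n\<ge>N. \<forall>k\<ge>N. dist (poly_op (q' n) A) (poly_op (q k) A) \<le> e / 2"
        using close[OF q' q, of "e / 2"] by auto
      then show "\<exists>no. \<forall>n\<ge>no. dist (poly_op (q' n) A - poly_op (q n) A) 0 < e"
        using \<open>0 < e\<close> by (intro exI[of _ N]) (force simp: dist_norm)
    qed
    from tendsto_add[OF this T] show ?thesis by simp
  qed
  have "fcalc h A = T"
    unfolding fcalc_def
  proof (rule the_equality)
    fix T' assume "\<forall>p. uniform_limit (op_spec A) (\<lambda>n t. poly (p n) t) h sequentially \<longrightarrow>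
       (\<lambda>n. poly_op (p n) A) \<longlonglongrightarrow> T'"
    with q have "(\<lambda>n. poly_op (q n) A) \<longlonglongrightarrow> T'" by blast
    then show "T' = T" using T by (rule LIMSEQ_unique)
  qed (use all in blast)
  then show ?thesis using all[OF p] by simp
qed

section \<open>Rules of the functional calculus\<close>

lemma fcalc_cong:
  assumes "A \<in> PD" "\<And>t. 0 < t \<Longrightarrow> h t = k t"
  shows "fcalc h A = fcalc k A"
proof -
  have "uniform_limit (op_spec A) P h F = uniform_limit (op_spec A) P k F" for P and F :: "nat filter"
    by (rule uniform_limit_cong') (use assms PD_spec_pos in auto)
  then show ?thesis by (simp add: fcalc_def)
qed

lemma fcalc_poly:
  assumes A: "A \<in> PD"
  shows "fcalc (poly p) A = poly_op p A"
proof -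
  have "(\<lambda>n. poly_op p A) \<longlonglongrightarrow> fcalc (poly p) A"
    by (rule fcalc_tendsto[OF A]) (auto intro!: continuous_intros uniform_limitI)
  then show ?thesis by (metis LIMSEQ_unique tendsto_const)
qed

lemma fcalc_mult:
  assumes A: "A \<in> PD" and h: "continuous_on {0<..} h" and k: "continuous_on {0<..} k"
  shows "fcalc h A o\<^sub>L fcalc k A = fcalc (\<lambda>t. h t * k t) A"
proof -
  obtain p q where p: "uniform_limit (op_spec A) (\<lambda>n t. poly (p n) t) h sequentially"
    and q: "uniform_limit (op_spec A) (\<lambda>n t. poly (q n) t) k sequentially"
    using PD_poly_approx[OF A h] PD_poly_approx[OF A k] by metis
  have "uniform_limit (op_spec A) (\<lambda>n t. poly (p n * q n) t) (\<lambda>t. h t * k t) sequentially"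
    using uniform_lim_mult[OF p q PD_bounded_image[OF A h] PD_bounded_image[OF A k]] by simp
  then have "(\<lambda>n. poly_op (p n * q n) A) \<longlonglongrightarrow> fcalc (\<lambda>t. h t * k t) A"
    by (intro fcalc_tendsto[OF A] continuous_on_mult h k)
  moreover have "(\<lambda>n. poly_op (p n * q n) A) \<longlonglongrightarrow> (fcalc h A o\<^sub>L fcalc k A)"
    unfolding poly_op_mult by (intro tendsto_intros fcalc_tendsto[OF A] h k p q)
  ultimately show ?thesis by (rule LIMSEQ_unique[rotated])
qed

lemma fcalc_selfadj:
  assumes A: "A \<in> PD" and h: "continuous_on {0<..} h"
  shows "selfadj (fcalc h A)"
proof -
  obtain p where "uniform_limit (op_spec A) (\<lambda>n t. poly (p n) t) h sequentially"
    using PD_poly_approx[OF A h] .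
  then have lim: "(\<lambda>n. poly_op (p n) A x) \<longlonglongrightarrow> fcalc h A x" for x
    by (intro tendsto_blinfun_at fcalc_tendsto[OF A h])
  have sa: "selfadj (poly_op (p n) A)" for n by (rule selfadj_poly_op[OF PD_selfadj[OF A]])
  have "fcalc h A (imult x) = imult (fcalc h A x)" for x
  proof (rule LIMSEQ_unique[OF lim])
    show "(\<lambda>n. poly_op (p n) A (imult x)) \<longlonglongrightarrow> imult (fcalc h A x)"
      by (simp add: BH_D[OF selfadj_BH[OF sa]] bounded_linear.tendsto[OF bounded_linear_imult] lim)
  qed
  moreover have "inner (fcalc h A x) y = inner x (fcalc h A y)" for x y
  proof (rule LIMSEQ_unique)
    show "(\<lambda>n. inner (poly_op (p n) A x) y) \<longlonglongrightarrow> inner (fcalc h A x) y"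
      by (intro tendsto_intros lim)
    show "(\<lambda>n. inner (poly_op (p n) A x) y) \<longlonglongrightarrow> inner x (fcalc h A y)"
      unfolding selfadj_inner[OF sa] by (intro tendsto_intros lim)
  qed
  ultimately show ?thesis by (simp add: selfadj_def BH_def)
qed

lemma fcalc_commute:
  assumes A: "A \<in> PD" and h: "continuous_on {0<..} h" and P: "A o\<^sub>L P = P o\<^sub>L A"
  shows "fcalc h A o\<^sub>L P = P o\<^sub>L fcalc h A"
proof -
  obtain p where p: "uniform_limit (op_spec A) (\<lambda>n t. poly (p n) t) h sequentially"
    using PD_poly_approx[OF A h] .
  show ?thesis
  proof (rule LIMSEQ_unique)
    show "(\<lambda>n. poly_op (p n) A o\<^sub>L P) \<longlonglongrightarrow> (fcalc h A o\<^sub>L P)"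
      by (intro tendsto_intros fcalc_tendsto[OF A h p])
    show "(\<lambda>n. poly_op (p n) A o\<^sub>L P) \<longlonglongrightarrow> (P o\<^sub>L fcalc h A)"
      unfolding poly_op_commute[OF P] by (intro tendsto_intros fcalc_tendsto[OF A h p])
  qed
qed

lemma fcalc_eigenvector:
  fixes A :: "'a::chilbert \<Rightarrow>\<^sub>L 'a"
  assumes A: "A \<in> PD" and h: "continuous_on {0<..} h" and x: "A x = l *\<^sub>R x"
  shows "fcalc h A x = h l *\<^sub>R x"
proof (cases "x = 0")
  case False
  have "l \<in> op_spec A"
  proof (rule ccontr)
    assume "l \<notin> op_spec A"
    then obtain B where B: "B o\<^sub>L (A - l *\<^sub>R id_blinfun) = id_blinfun"
      by (auto simp: op_spec_def op_invertible_def)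
    have "(B o\<^sub>L (A - l *\<^sub>R id_blinfun)) x = 0" by (simp add: blinfun.bilinear_simps x)
    then show False using False unfolding B by simp
  qed
  obtain p where p: "uniform_limit (op_spec A) (\<lambda>n t. poly (p n) t) h sequentially"
    using PD_poly_approx[OF A h] .
  show ?thesis
  proof (rule LIMSEQ_unique)
    show "(\<lambda>n. poly_op (p n) A x) \<longlonglongrightarrow> fcalc h A x"
      by (intro tendsto_blinfun_at fcalc_tendsto[OF A h p])
    show "(\<lambda>n. poly_op (p n) A x) \<longlonglongrightarrow> h l *\<^sub>R x"
      unfolding poly_op_eigenvector[of A, OF x]
      by (intro tendsto_intros tendsto_uniform_limitI[OF p] \<open>l \<in> op_spec A\<close>)
  qed
qed simp

lemma fcalc_scaleR_id:
  assumes "continuous_on {0<..} h" "0 < t"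
  shows "fcalc h (t *\<^sub>R id_blinfun) = h t *\<^sub>R id_blinfun"
proof (rule blinfun_eqI)
  fix x
  show "fcalc h (t *\<^sub>R id_blinfun) x = (h t *\<^sub>R id_blinfun) x"
    using fcalc_eigenvector[OF PD_scaleR_id[OF assms(2)] assms(1), of x t]
    by (simp add: blinfun.bilinear_simps)
qed

lemma fcalc_quadratic:
  fixes A :: "'a::chilbert \<Rightarrow>\<^sub>L 'a"
  assumes A: "A \<in> PD" and h: "continuous_on {0<..} h"
    and x: "A (A x) = (l + l') *\<^sub>R A x - (l * l') *\<^sub>R x"
    and hl: "h l = u + v * l" "h l' = u + v * l'"
  shows "fcalc h A x = u *\<^sub>R x + v *\<^sub>R A x"
proof (cases "l = l'")
  case True
  have sa: "selfadj A" using A by (rule PD_selfadj)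
  have "inner (A x - l *\<^sub>R x) (A x - l *\<^sub>R x) = inner (A (A x)) x - 2 * l * inner (A x) x + l * l * inner x x"
    by (simp add: inner_simps selfadj_inner[OF sa] inner_commute algebra_simps)
  also have "\<dots> = 0" by (simp add: x True inner_simps algebra_simps)
  finally have "A x = l *\<^sub>R x" by simp
  then show ?thesis
    using fcalc_eigenvector[OF A h, of x l] by (simp add: hl(1) algebra_simps)
next
  case False
  define y where "y = A x - l' *\<^sub>R x"
  define z where "z = A x - l *\<^sub>R x"
  have "A y = l *\<^sub>R y" "A z = l' *\<^sub>R z"
    by (simp_all add: y_def z_def blinfun.bilinear_simps x algebra_simps)
  then have yz: "fcalc h A y = h l *\<^sub>R y" "fcalc h A z = h l' *\<^sub>R z"
    by (simp_all add: fcalc_eigenvector[OF A h])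
  have "(l - l') *\<^sub>R x = y - z" by (simp add: y_def z_def algebra_simps)
  then have "(l - l') *\<^sub>R fcalc h A x = fcalc h A y - fcalc h A z"
    by (metis blinfun.diff_right blinfun.scaleR_right)
  also have "\<dots> = (l - l') *\<^sub>R (u *\<^sub>R x + v *\<^sub>R A x)"
    unfolding yz hl by (simp add: y_def z_def algebra_simps)
  finally show ?thesis using False by simp
qed

section \<open>Positivity, composition and injectivity of the calculus\<close>

lemma op_square_PD:
  assumes "selfadj R" "op_invertible R"
  shows "R o\<^sub>L R \<in> PD"
proof (rule PD_I)
  show "selfadj (R o\<^sub>L R)" using assms by (simp add: selfadj_compose)
  show "0 \<le> inner ((R o\<^sub>L R) x) x" for x using selfadj_inner[OF assms(1), of "R x" x] by simp
qed (use assms op_invertible_compose in blast)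

lemma congruence_PD:
  assumes S: "selfadj S" "op_invertible S" and A: "A \<in> PD"
  shows "S o\<^sub>L A o\<^sub>L S \<in> PD"
proof (rule PD_I)
  show "selfadj (S o\<^sub>L A o\<^sub>L S)" using S PD_selfadj[OF A] by simp
  show "0 \<le> inner ((S o\<^sub>L A o\<^sub>L S) x) x" for x
    using PD_inner_nonneg[OF A, of "S x"] by (simp add: selfadj_inner[OF S(1)])
  show "op_invertible (S o\<^sub>L A o\<^sub>L S)"
    using S A by (intro op_invertible_compose) (auto simp: PD_def)
qed

text \<open>h(A) is the square of (sqrt h)(A), which has the inverse (1 / sqrt h)(A).\<close>

lemma fcalc_PD:
  assumes A: "A \<in> PD" and h: "continuous_on {0<..} h" and pos: "\<And>t. 0 < t \<Longrightarrow> 0 < h t"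
  shows "fcalc h A \<in> PD"
proof -
  have c: "continuous_on {0<..} (\<lambda>t. sqrt (h t))" "continuous_on {0<..} (\<lambda>t. 1 / sqrt (h t))"
    using pos by (force intro!: continuous_intros h)+
  have "fcalc (\<lambda>t. sqrt (h t)) A o\<^sub>L fcalc (\<lambda>t. 1 / sqrt (h t)) A = fcalc (poly 1) A"
    "fcalc (\<lambda>t. 1 / sqrt (h t)) A o\<^sub>L fcalc (\<lambda>t. sqrt (h t)) A = fcalc (poly 1) A"
    using pos by (auto simp: fcalc_mult[OF A] c less_imp_neq[symmetric] intro!: fcalc_cong[OF A])
  moreover have "fcalc (poly 1) A = id_blinfun"
    by (simp add: fcalc_poly[OF A] one_pCons)
  ultimately have "op_invertible (fcalc (\<lambda>t. sqrt (h t)) A)"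
    using fcalc_selfadj[OF A c(1)] fcalc_selfadj[OF A c(2)]
    by (intro op_invertibleI) (auto intro: selfadj_BH)
  moreover have "fcalc h A = fcalc (\<lambda>t. sqrt (h t)) A o\<^sub>L fcalc (\<lambda>t. sqrt (h t)) A"
    using pos by (auto simp: fcalc_mult[OF A] c less_imp_le intro!: fcalc_cong[OF A])
  ultimately show ?thesis
    using op_square_PD[OF fcalc_selfadj[OF A c(1)]] by simp
qed

lemma fcalc_diff:
  assumes A: "A \<in> PD" and h: "continuous_on {0<..} h" and k: "continuous_on {0<..} k"
  shows "fcalc h A - fcalc k A = fcalc (\<lambda>t. h t - k t) A"
proof -
  obtain p q where p: "uniform_limit (op_spec A) (\<lambda>n t. poly (p n) t) h sequentially"
    and q: "uniform_limit (op_spec A) (\<lambda>n t. poly (q n) t) k sequentially"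
    using PD_poly_approx[OF A h] PD_poly_approx[OF A k] by metis
  have "uniform_limit (op_spec A) (\<lambda>n t. poly (p n - q n) t) (\<lambda>t. h t - k t) sequentially"
    using uniform_limit_minus[OF p q] by simp
  then have "(\<lambda>n. poly_op (p n - q n) A) \<longlonglongrightarrow> fcalc (\<lambda>t. h t - k t) A"
    by (intro fcalc_tendsto[OF A] continuous_on_diff h k)
  moreover have "(\<lambda>n. poly_op (p n - q n) A) \<longlonglongrightarrow> fcalc h A - fcalc k A"
    unfolding poly_op_diff by (intro tendsto_intros fcalc_tendsto[OF A] h k p q)
  ultimately show ?thesis by (rule LIMSEQ_unique[rotated])
qed

lemma norm_fcalc_le:
  assumes A: "A \<in> PD" and h: "continuous_on {0<..} h" and e: "0 \<le> e"
    and le: "\<And>r. r \<in> op_spec A \<Longrightarrow> \<bar>h r\<bar> \<le> e"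
  shows "norm (fcalc h A) \<le> e"
proof (rule field_le_epsilon)
  fix d :: real assume d: "0 < d"
  obtain p where p: "uniform_limit (op_spec A) (\<lambda>n t. poly (p n) t) h sequentially"
    using PD_poly_approx[OF A h] .
  have "\<forall>\<^sub>F n in sequentially. norm (poly_op (p n) A) \<le> e + d"
    using uniform_limitD[OF p d]
  proof eventually_elim
    case (elim n)
    have "\<bar>poly (p n) r\<bar> \<le> e + d" if "r \<in> op_spec A" for r
      using elim[rule_format, OF that] le[OF that] by (simp add: dist_real_def)
    then show ?case using e d by (intro norm_poly_op_le[OF PD_selfadj[OF A]]) auto
  qed
  then show "norm (fcalc h A) \<le> e + d"
    by (intro tendsto_upperbound[OF tendsto_norm[OF fcalc_tendsto[OF A h p]]]) auto
qed

lemma poly_op_fcalc: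
  assumes A: "A \<in> PD" and g: "continuous_on {0<..} g"
  shows "poly_op p (fcalc g A) = fcalc (\<lambda>t. poly p (g t)) A"
proof (induction p)
  case 0
  show ?case using fcalc_poly[OF A, of 0] fcalc_cong[OF A, of "\<lambda>t. poly 0 (g t)" "poly 0"] by simp
next
  case (pCons a p)
  have c: "continuous_on {0<..} (\<lambda>t. poly p (g t))" for p by (intro continuous_intros g)
  have "fcalc g A o\<^sub>L poly_op p (fcalc g A) = fcalc (\<lambda>t. g t * poly p (g t)) A"
    using pCons by (simp add: fcalc_mult[OF A g c])
  moreover have "fcalc (\<lambda>t. poly (pCons a p) (g t)) A - fcalc (\<lambda>t. g t * poly p (g t)) A = fcalc (poly [:a:]) A"
    unfolding fcalc_diff[OF A c continuous_on_mult[OF g c]] by (rule fcalc_cong[OF A]) simp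
  ultimately show ?case by (simp add: fcalc_poly[OF A] algebra_simps)
qed

lemma fcalc_compose:
  assumes A: "A \<in> PD" and g: "continuous_on {0<..} g" "\<And>t. 0 < t \<Longrightarrow> 0 < g t"
    and k: "continuous_on {0<..} k"
  shows "fcalc k (fcalc g A) = fcalc (\<lambda>t. k (g t)) A"
proof -
  let ?G = "fcalc g A"
  have G: "?G \<in> PD" using A g by (rule fcalc_PD)
  obtain m where m: "0 < m" "op_spec A \<subseteq> {m..norm A}" using PD_spec_bounds[OF A] .
  obtain m' where m': "0 < m'" "op_spec ?G \<subseteq> {m'..norm ?G}" using PD_spec_bounds[OF G] .
  \<comment> \<open>Covering both \<open>g\<close> of the spectrum of \<open>A\<close> and the
    spectrum of g(A) lets one polynomial serve both estimates.\<close>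
  define K where "K = g ` {m..norm A} \<union> {m'..norm ?G}"
  have "continuous_on {m..norm A} g" by (rule continuous_on_subset[OF g(1)]) (use m in auto)
  then have K: "compact K" unfolding K_def
    by (intro compact_Un compact_continuous_image) auto
  have Kpos: "K \<subseteq> {0<..}" unfolding K_def using m m' g(2) by fastforce
  have kg: "continuous_on {0<..} (\<lambda>t. k (g t))"
    by (rule continuous_on_compose2[OF k g(1)]) (use g(2) in auto)
  have "norm (fcalc k ?G - fcalc (\<lambda>t. k (g t)) A) \<le> e" if "0 < e" for e
  proof -
    obtain p where p: "\<And>t. t \<in> K \<Longrightarrow> \<bar>poly p t - k t\<bar> < e / 2"
      using weierstrass_poly[OF K continuous_on_subset[OF k Kpos], of "e / 2"] \<open>0 < e\<close> by auto
    have cp: "continuous_on {0<..} (poly p)" "continuous_on {0<..} (\<lambda>t. poly p (g t))"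
      by (intro continuous_intros g)+
    have "norm (poly_op p ?G - fcalc k ?G) \<le> e / 2"
      unfolding fcalc_poly[OF G, symmetric] fcalc_diff[OF G cp(1) k]
    proof (rule norm_fcalc_le[OF G])
      fix r assume "r \<in> op_spec ?G"
      then have "r \<in> K" using m' by (auto simp: K_def)
      then show "\<bar>poly p r - k r\<bar> \<le> e / 2" using p by (simp add: less_imp_le)
    qed (use \<open>0 < e\<close> in \<open>auto intro!: continuous_intros k\<close>)
    moreover have "norm (poly_op p ?G - fcalc (\<lambda>t. k (g t)) A) \<le> e / 2"
      unfolding poly_op_fcalc[OF A g(1)] fcalc_diff[OF A cp(2) kg]
    proof (rule norm_fcalc_le[OF A])
      fix r assume "r \<in> op_spec A"
      then have "g r \<in> K" using m by (auto simp: K_def)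
      then show "\<bar>poly p (g r) - k (g r)\<bar> \<le> e / 2" using p by (simp add: less_imp_le)
    qed (use \<open>0 < e\<close> in \<open>auto intro!: continuous_intros kg g\<close>)
    moreover have "norm (fcalc k ?G - fcalc (\<lambda>t. k (g t)) A)
      \<le> norm (poly_op p ?G - fcalc k ?G) + norm (poly_op p ?G - fcalc (\<lambda>t. k (g t)) A)"
      using dist_triangle3[of "fcalc k ?G" "fcalc (\<lambda>t. k (g t)) A" "poly_op p ?G"] by (simp add: dist_norm)
    ultimately show ?thesis by simp
  qed
  then show ?thesis
    by (metis dense_ge norm_le_zero_iff right_minus_eq)
qed

text \<open>Allows the outer \<open>g\<close> to be cancelled in the associative law: the calculus
  of the inverse function undoes that of \<open>g\<close>.\<close>

lemma fcalc_inj: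
  fixes A B :: "'a::chilbert \<Rightarrow>\<^sub>L 'a"
  assumes A: "A \<in> PD" and B: "B \<in> PD" and g: "continuous_on {0<..} g" "strict_mono_on {0<..} g"
    and surj: "g ` {0<..} = {0<..}" and eq: "fcalc g A = fcalc g B"
  shows "A = B"
proof -
  let ?k = "the_inv_into {0<..} g"
  have inj: "inj_on g {0<..}" using g(2) by (rule strict_mono_on_imp_inj_on)
  have kg: "0 < t \<Longrightarrow> ?k (g t) = t" for t by (simp add: the_inv_into_f_f[OF inj])
  have gpos: "0 < t \<Longrightarrow> 0 < g t" for t using surj by auto
  have "open (g ` U)" if "open U" "U \<subseteq> {0<..}" for U
    using that g(1) inj by (intro injective_into_1d_imp_open_map_UNIV[of U "{0<..}"])
  then have k: "continuous_on {0<..} ?k"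
    using surj kg gpos by (intro continuous_on_inverse_open_map[OF g(1)])
      (auto simp: openin_open_eq subset_iff)
  have "fcalc ?k (fcalc g C) = C" if "C \<in> PD" for C :: "'a \<Rightarrow>\<^sub>L 'a"
  proof -
    have "fcalc ?k (fcalc g C) = fcalc (\<lambda>t. ?k (g t)) C"
      by (rule fcalc_compose[OF that g(1) gpos k])
    also have "\<dots> = fcalc (poly [:0, 1:]) C"
      by (rule fcalc_cong[OF that]) (simp add: kg)
    finally show ?thesis by (simp add: fcalc_poly[OF that])
  qed
  then show ?thesis using A B eq by metis
qed

lemma continuous_on_inverse_sqrt: "continuous_on {0<..} (\<lambda>t. 1 / sqrt t)"
  by (auto intro!: continuous_intros)

lemma continuous_on_sqrt_pos: "continuous_on {0<..} sqrt"
  by (auto intro!: continuous_intros)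

lemma sqrt_calculus:
  assumes A: "A \<in> PD"
  defines "S \<equiv> fcalc sqrt A" and "T \<equiv> fcalc (\<lambda>t. 1 / sqrt t) A"
  shows "S \<in> PD" "T \<in> PD" "S o\<^sub>L S = A" "S o\<^sub>L T = id_blinfun" "T o\<^sub>L S = id_blinfun"
proof -
  note c = continuous_on_sqrt_pos continuous_on_inverse_sqrt
  show "S \<in> PD" "T \<in> PD" unfolding S_def T_def by (auto intro!: fcalc_PD[OF A] c)
  have "S o\<^sub>L S = fcalc (poly [:0, 1:]) A" "S o\<^sub>L T = fcalc (poly 1) A" "T o\<^sub>L S = fcalc (poly 1) A"
    unfolding S_def T_def by (auto simp: fcalc_mult[OF A] c intro!: fcalc_cong[OF A])
  then show "S o\<^sub>L S = A" "S o\<^sub>L T = id_blinfun" "T o\<^sub>L S = id_blinfun"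
    by (simp_all add: fcalc_poly[OF A] one_pCons)
qed

lemma PD_invertible: "A \<in> PD \<Longrightarrow> op_invertible A"
  by (simp add: PD_def)

lemma kubo_ando_PD:
  assumes A: "A \<in> PD" and B: "B \<in> PD" and f: "continuous_on {0<..} f" "\<And>t. 0 < t \<Longrightarrow> 0 < f t"
  shows "kubo_ando f A B \<in> PD"
  unfolding kubo_ando_def
  by (intro congruence_PD fcalc_PD B f PD_selfadj PD_invertible sqrt_calculus[OF A])

section \<open>Blocks on a common invariant subspace\<close>

text \<open>For a projection \<open>P\<close> this says that \<open>A\<close> preserves the range
  and the kernel of \<open>P\<close> and acts on the range as \<open>M\<close>. Off the range
  \<open>A\<close> stays unspecified, so operators are compared through their blocks.\<close>

definition block :: "('a::chilbert \<Rightarrow>\<^sub>L 'a) \<Rightarrow> ('a \<Rightarrow>\<^sub>L 'a) \<Rightarrow> ('a \<Rightarrow>\<^sub>L 'a) \<Rightarrow> bool" where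
  "block P A M \<longleftrightarrow> A o\<^sub>L P = M \<and> P o\<^sub>L A = M"

lemma block_unique: "block P A M \<Longrightarrow> block P A N \<Longrightarrow> M = N"
  by (simp add: block_def)

lemma block_scaleR_id: "block P (t *\<^sub>R id_blinfun) (t *\<^sub>R P)"
  by (simp add: block_def compose_simps)

lemma block_fcalc:
  fixes A :: "'a::chilbert \<Rightarrow>\<^sub>L 'a"
  assumes A: "A \<in> PD" and h: "continuous_on {0<..} h"
    and M: "block P A M" and MM: "M o\<^sub>L M = (l + l') *\<^sub>R M - (l * l') *\<^sub>R P" and PP: "P o\<^sub>L P = P"
    and hl: "h l = u + v * l" "h l' = u + v * l'"
  shows "block P (fcalc h A) (u *\<^sub>R P + v *\<^sub>R M)"
proof -
  have AP: "A o\<^sub>L P = M" "P o\<^sub>L A = M" using M by (auto simp: block_def)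
  have "A o\<^sub>L (A o\<^sub>L P) = M o\<^sub>L M"
    using AP by (metis PP compose_assoc)
  then have "A (A (P y)) = (M o\<^sub>L M) y" for y by (metis blinfun_apply_blinfun_compose)
  then have "A (A (P y)) = (l + l') *\<^sub>R A (P y) - (l * l') *\<^sub>R P y" for y
    unfolding MM by (simp add: AP(1)[symmetric] blinfun.bilinear_simps)
  from fcalc_quadratic[OF A h this hl] have "fcalc h A o\<^sub>L P = u *\<^sub>R P + v *\<^sub>R M"
    by (intro blinfun_eqI) (simp add: blinfun.bilinear_simps AP(1)[symmetric])
  moreover have "fcalc h A o\<^sub>L P = P o\<^sub>L fcalc h A"
    by (rule fcalc_commute[OF A h]) (simp add: AP)
  ultimately show ?thesis by (simp add: block_def)
qed

text \<open>\<open>Y\<close> is the block of \<open>A\<^sup>-\<^sup>1 B\<close>, which has the same eigenvalues as that of \<open>A\<^sup>-\<^sup>1\<^sup>/\<^sup>2 B A\<^sup>-\<^sup>1\<^sup>/\<^sup>2\<close>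
  but needs no square roots.\<close>

lemma block_kubo_ando:
  fixes A :: "'a::chilbert \<Rightarrow>\<^sub>L 'a"
  assumes A: "A \<in> PD" and B: "B \<in> PD" and f: "continuous_on {0<..} f"
    and M: "block P A M" and N: "block P B N" and PP: "P o\<^sub>L P = P"
    and Y: "M o\<^sub>L Y = N" "P o\<^sub>L Y = Y" "Y o\<^sub>L Y = (k + k') *\<^sub>R Y - (k * k') *\<^sub>R P"
    and fk: "f k = \<alpha> + \<beta> * k" "f k' = \<alpha> + \<beta> * k'"
  shows "block P (kubo_ando f A B) (\<alpha> *\<^sub>R M + \<beta> *\<^sub>R N)"
proof -
  define S where "S = fcalc sqrt A"
  define T where "T = fcalc (\<lambda>t. 1 / sqrt t) A"
  define X where "X = T o\<^sub>L B o\<^sub>L T"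
  define F where "F = fcalc f X"
  note sq = sqrt_calculus[OF A, folded S_def T_def]
  have X: "X \<in> PD"
    unfolding X_def by (intro congruence_PD B PD_selfadj PD_invertible sq)
  have AP: "A o\<^sub>L P = M" "P o\<^sub>L A = M" and BP: "B o\<^sub>L P = N" "P o\<^sub>L B = N"
    using M N by (auto simp: block_def)
  have SP: "S o\<^sub>L P = P o\<^sub>L S" "T o\<^sub>L P = P o\<^sub>L T"
    unfolding S_def T_def using AP
    by (auto intro!: fcalc_commute[OF A] continuous_on_sqrt_pos continuous_on_inverse_sqrt)
  have XP: "X o\<^sub>L P = T o\<^sub>L N o\<^sub>L T" "P o\<^sub>L X = T o\<^sub>L N o\<^sub>L T"
    unfolding X_def using SP BP by (metis compose_assoc)+
  have TA: "T o\<^sub>L (T o\<^sub>L A) = id_blinfun"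
    using sq by (metis compose_assoc compose_id(1))
  have TMT: "T o\<^sub>L M o\<^sub>L T = P"
  proof -
    have "T o\<^sub>L M o\<^sub>L T = T o\<^sub>L S o\<^sub>L (S o\<^sub>L T) o\<^sub>L P"
      using AP SP sq by (metis compose_assoc)
    then show ?thesis by (simp add: sq)
  qed
  have TTN: "T o\<^sub>L (T o\<^sub>L N) = Y"
  proof -
    have "T o\<^sub>L (T o\<^sub>L N) = T o\<^sub>L (T o\<^sub>L A) o\<^sub>L (P o\<^sub>L Y)"
      using Y AP by (metis compose_assoc)
    then show ?thesis by (simp add: TA Y)
  qed
  have PN: "P o\<^sub>L N = N" using BP PP by (metis compose_assoc)
  \<comment> \<open>Since Y = T T N, the square of T N T is T N Y T, which passes the quadratic
    equation of Y on to T N T.\<close>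
  have "(T o\<^sub>L N o\<^sub>L T) o\<^sub>L (T o\<^sub>L N o\<^sub>L T) = T o\<^sub>L (N o\<^sub>L Y) o\<^sub>L T"
    by (simp add: TTN[symmetric] compose_assoc)
  also have "N o\<^sub>L Y = (k + k') *\<^sub>R N - (k * k') *\<^sub>R (M o\<^sub>L P)"
    unfolding Y(1)[symmetric] compose_assoc Y(3) by (simp add: compose_simps)
  also have "M o\<^sub>L P = M" using AP PP by (metis compose_assoc)
  finally have "(T o\<^sub>L N o\<^sub>L T) o\<^sub>L (T o\<^sub>L N o\<^sub>L T) = (k + k') *\<^sub>R (T o\<^sub>L N o\<^sub>L T) - (k * k') *\<^sub>R P"
    by (simp add: compose_simps TMT)
  then have "block P F (\<alpha> *\<^sub>R P + \<beta> *\<^sub>R (T o\<^sub>L N o\<^sub>L T))"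
    unfolding F_def by (intro block_fcalc[OF X f _ _ PP fk]) (auto simp: block_def XP)
  then have FP: "F o\<^sub>L P = \<alpha> *\<^sub>R P + \<beta> *\<^sub>R (T o\<^sub>L N o\<^sub>L T)" "P o\<^sub>L F = \<alpha> *\<^sub>R P + \<beta> *\<^sub>R (T o\<^sub>L N o\<^sub>L T)"
    by (auto simp: block_def)
  have SPS: "S o\<^sub>L P o\<^sub>L S = M" using SP AP sq by (metis compose_assoc)
  have "S o\<^sub>L (T o\<^sub>L N o\<^sub>L T) o\<^sub>L S = (S o\<^sub>L T) o\<^sub>L N o\<^sub>L (T o\<^sub>L S)" by (simp only: compose_assoc)
  then have STS: "S o\<^sub>L (T o\<^sub>L N o\<^sub>L T) o\<^sub>L S = N" by (simp add: sq)
  have "S o\<^sub>L F o\<^sub>L S o\<^sub>L P = S o\<^sub>L (F o\<^sub>L P) o\<^sub>L S" "P o\<^sub>L (S o\<^sub>L F o\<^sub>L S) = S o\<^sub>L (P o\<^sub>L F) o\<^sub>L S"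
    using SP by (metis compose_assoc)+
  then have "block P (S o\<^sub>L F o\<^sub>L S) (\<alpha> *\<^sub>R M + \<beta> *\<^sub>R N)"
    unfolding FP by (simp add: block_def compose_simps SPS STS)
  then show ?thesis by (simp add: kubo_ando_def S_def T_def X_def F_def)
qed

section \<open>The arithmetic and the harmonic mean\<close>

lemma kubo_ando_arithmetic:
  assumes f: "\<And>t. 0 < t \<Longrightarrow> f t = (1 + t) / 2" and A: "A \<in> PD" and B: "B \<in> PD"
  shows "kubo_ando f A B = (1/2) *\<^sub>R (A + B)"
proof -
  define S where "S = fcalc sqrt A"
  define T where "T = fcalc (\<lambda>t. 1 / sqrt t) A"
  define X where "X = T o\<^sub>L B o\<^sub>L T"
  note sq = sqrt_calculus[OF A, folded S_def T_def]
  have X: "X \<in> PD"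
    unfolding X_def by (intro congruence_PD B PD_selfadj PD_invertible sq)
  have "fcalc f X = fcalc (poly [:1/2, 1/2:]) X"
    by (rule fcalc_cong[OF X]) (simp add: f field_simps)
  then have "fcalc f X = (1/2) *\<^sub>R (id_blinfun + X)"
    by (simp add: fcalc_poly[OF X] compose_simps algebra_simps)
  then have "kubo_ando f A B = (1/2) *\<^sub>R ((S o\<^sub>L S) + (S o\<^sub>L X o\<^sub>L S))"
    by (simp add: kubo_ando_def S_def T_def X_def compose_simps)
  also have "S o\<^sub>L X o\<^sub>L S = (S o\<^sub>L T) o\<^sub>L B o\<^sub>L (T o\<^sub>L S)"
    unfolding X_def by (simp only: compose_assoc)
  finally show ?thesis by (simp add: sq)
qed

text \<open>The sum of the inverses of A and B is T (1 + X^-1) T, and (1 + X^-1) f(X) = 2 for this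
  \<open>f\<close>.\<close>

lemma kubo_ando_harmonic:
  assumes f: "\<And>t. 0 < t \<Longrightarrow> f t = 2 * t / (1 + t)" and A: "A \<in> PD" and B: "B \<in> PD"
  shows "kubo_ando f A B = 2 *\<^sub>R op_inv (op_inv A + op_inv B)"
proof -
  define S where "S = fcalc sqrt A"
  define T where "T = fcalc (\<lambda>t. 1 / sqrt t) A"
  define X where "X = T o\<^sub>L B o\<^sub>L T"
  define F where "F = fcalc f X"
  note sq = sqrt_calculus[OF A, folded S_def T_def]
  have X: "X \<in> PD"
    unfolding X_def by (intro congruence_PD B PD_selfadj PD_invertible sq)
  obtain B' where B': "B o\<^sub>L B' = id_blinfun" "B' o\<^sub>L B = id_blinfun"
    using PD_invertible[OF B] unfolding op_invertible_def by blast
  define X' where "X' = S o\<^sub>L B' o\<^sub>L S"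
  have XX: "X o\<^sub>L X' = id_blinfun" "X' o\<^sub>L X = id_blinfun"
    unfolding X_def X'_def using sq B' by (metis compose_assoc compose_id(2))+
  have "continuous_on {0<..} f \<longleftrightarrow> continuous_on {0<..} (\<lambda>t::real. 2 * t / (1 + t))"
    by (rule continuous_on_cong) (auto simp: f)
  also have "\<dots>" by (intro continuous_intros) auto
  finally have cf: "continuous_on {0<..} f" .
  have ft: "f t + t * f t = 2 * t" if "0 < t" for t
    using that by (simp add: f divide_simps) (simp add: algebra_simps)
  have "F o\<^sub>L fcalc (poly [:1, 1:]) X = fcalc (poly [:0, 2:]) X"
    "fcalc (poly [:1, 1:]) X o\<^sub>L F = fcalc (poly [:0, 2:]) X"
    unfolding F_def using cf
    by (auto simp: fcalc_mult[OF X] continuous_intros ft algebra_simps intro!: fcalc_cong[OF X])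
  then have "F o\<^sub>L (id_blinfun + X) = 2 *\<^sub>R X" "(id_blinfun + X) o\<^sub>L F = 2 *\<^sub>R X"
    by (simp_all add: fcalc_poly[OF X] compose_simps)
  then have "F o\<^sub>L (id_blinfun + X) o\<^sub>L X' = 2 *\<^sub>R id_blinfun" "X' o\<^sub>L ((id_blinfun + X) o\<^sub>L F) = 2 *\<^sub>R id_blinfun"
    by (simp_all add: compose_simps XX)
  moreover have "(id_blinfun + X) o\<^sub>L X' = id_blinfun + X'" "X' o\<^sub>L (id_blinfun + X) = id_blinfun + X'"
    by (simp_all add: compose_simps XX add.commute)
  ultimately have FX: "F o\<^sub>L (id_blinfun + X') = 2 *\<^sub>R id_blinfun" "(id_blinfun + X') o\<^sub>L F = 2 *\<^sub>R id_blinfun"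
    by (metis compose_assoc)+
  have iA: "op_inv A = T o\<^sub>L T"
    by (rule op_inv_eq) (metis sq compose_assoc compose_id)+
  have iB: "op_inv B = B'" using B' by (rule op_inv_eq)
  have "T o\<^sub>L X' o\<^sub>L T = (T o\<^sub>L S) o\<^sub>L B' o\<^sub>L (S o\<^sub>L T)"
    unfolding X'_def by (simp only: compose_assoc)
  then have sum: "op_inv A + op_inv B = T o\<^sub>L (id_blinfun + X') o\<^sub>L T"
    by (simp add: iA iB compose_simps sq)
  have 1: "(T o\<^sub>L (id_blinfun + X') o\<^sub>L T) o\<^sub>L (S o\<^sub>L F o\<^sub>L S) = 2 *\<^sub>R id_blinfun"
  proof -
    have "(T o\<^sub>L (id_blinfun + X') o\<^sub>L T) o\<^sub>L (S o\<^sub>L F o\<^sub>L S)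
       = T o\<^sub>L ((id_blinfun + X') o\<^sub>L ((T o\<^sub>L S) o\<^sub>L F)) o\<^sub>L S"
      by (simp only: compose_assoc)
    then show ?thesis unfolding sq compose_id FX by (simp add: compose_simps sq)
  qed
  have 2: "(S o\<^sub>L F o\<^sub>L S) o\<^sub>L (T o\<^sub>L (id_blinfun + X') o\<^sub>L T) = 2 *\<^sub>R id_blinfun"
  proof -
    have "(S o\<^sub>L F o\<^sub>L S) o\<^sub>L (T o\<^sub>L (id_blinfun + X') o\<^sub>L T)
       = S o\<^sub>L ((F o\<^sub>L (S o\<^sub>L T)) o\<^sub>L (id_blinfun + X')) o\<^sub>L T"
      by (simp only: compose_assoc)
    then show ?thesis unfolding sq compose_id FX by (simp add: compose_simps sq)
  qed
  have "op_inv (op_inv A + op_inv B) = (1/2) *\<^sub>R (S o\<^sub>L F o\<^sub>L S)"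
    unfolding sum
    by (rule op_inv_eq) (simp_all only: 1 2 compose_simps(5,6), simp_all)
  then show ?thesis by (simp add: kubo_ando_def S_def T_def X_def F_def)
qed

section \<open>Two-by-two matrices acting on an orthonormal pair\<close>

text \<open>The complex rank-one operator sending x to <x, v> u; the second summand carries the
  imaginary part of the inner product.\<close>

definition ketbra :: "'a::chilbert \<Rightarrow> 'a \<Rightarrow> 'a \<Rightarrow>\<^sub>L 'a" where
  "ketbra u v = Blinfun (\<lambda>x. inner x v *\<^sub>R u + inner x (imult v) *\<^sub>R imult u)"

lemma ketbra_apply: "ketbra u v x = inner x v *\<^sub>R u + inner x (imult v) *\<^sub>R imult u"
  unfolding ketbra_def
  by (subst bounded_linear_Blinfun_apply)
    (auto intro!: bounded_linear_add bounded_linear_scaleR_left[THEN bounded_linear_compose]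
      bounded_linear_inner_left)

locale orthonormal_pair =
  fixes e1 e2 :: "'a::chilbert"
  assumes e11: "inner e1 e1 = 1" and e22: "inner e2 e2 = 1"
    and e12: "inner e1 e2 = 0" and e12': "inner e1 (imult e2) = 0"
begin

text \<open>The real matrix with rows (a, b) and (c, d) in the basis \<open>e1\<close>,
  \<open>e2\<close>, extended by zero to the orthogonal complement.\<close>

definition psi :: "real \<Rightarrow> real \<Rightarrow> real \<Rightarrow> real \<Rightarrow> 'a \<Rightarrow>\<^sub>L 'a" where
  "psi a b c d = a *\<^sub>R ketbra e1 e1 + b *\<^sub>R ketbra e1 e2 + c *\<^sub>R ketbra e2 e1 + d *\<^sub>R ketbra e2 e2"

abbreviation P :: "'a \<Rightarrow>\<^sub>L 'a" where "P \<equiv> psi 1 0 0 1"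

lemma e_simps:
  "inner e1 e1 = 1" "inner e2 e2 = 1" "inner e1 e2 = 0" "inner e2 e1 = 0"
  "inner e1 (imult e2) = 0" "inner e2 (imult e1) = 0" "inner (imult e2) e1 = 0" "inner (imult e1) e2 = 0"
  "inner (imult e1) e1 = 0" "inner (imult e2) e2 = 0"
  using e11 e22 e12 e12' inner_imult_left[of e1 e2]
  by (auto simp: inner_commute)

lemma psi_apply: "psi a b c d x =
    (a * inner x e1 + b * inner x e2) *\<^sub>R e1 + (a * inner x (imult e1) + b * inner x (imult e2)) *\<^sub>R imult e1
  + (c * inner x e1 + d * inner x e2) *\<^sub>R e2 + (c * inner x (imult e1) + d * inner x (imult e2)) *\<^sub>R imult e2"
  by (simp add: psi_def ketbra_apply blinfun.bilinear_simps algebra_simps)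

lemma psi_mult: "psi a b c d o\<^sub>L psi a' b' c' d' =
    psi (a * a' + b * c') (a * b' + b * d') (c * a' + d * c') (c * b' + d * d')"
  by (rule blinfun_eqI) (simp add: psi_apply inner_simps e_simps algebra_simps)

lemma psi_add: "psi a b c d + psi a' b' c' d' = psi (a + a') (b + b') (c + c') (d + d')"
  by (simp add: psi_def algebra_simps)

lemma psi_diff: "psi a b c d - psi a' b' c' d' = psi (a - a') (b - b') (c - c') (d - d')"
  by (simp add: psi_def algebra_simps)

lemma psi_scaleR: "r *\<^sub>R psi a b c d = psi (r * a) (r * b) (r * c) (r * d)"
  by (simp add: psi_def algebra_simps)

lemmas psi_simps = psi_add psi_diff psi_scaleR psi_mult

lemma psi_eq_iff: "psi a b c d = psi a' b' c' d' \<longleftrightarrow> a = a' \<and> b = b' \<and> c = c' \<and> d = d'"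
proof
  assume eq: "psi a b c d = psi a' b' c' d'"
  have "inner (psi a b c d e1) e1 = a" "inner (psi a b c d e2) e1 = b"
    "inner (psi a b c d e1) e2 = c" "inner (psi a b c d e2) e2 = d" for a b c d
    by (simp_all add: psi_apply inner_simps e_simps)
  then show "a = a' \<and> b = b' \<and> c = c' \<and> d = d'" by (metis eq)
qed simp

lemma psi_cayley_hamilton:
  "psi a b c d o\<^sub>L psi a b c d = (a + d) *\<^sub>R psi a b c d - (a * d - b * c) *\<^sub>R P"
  by (simp add: psi_simps algebra_simps)

lemma psi_selfadj: "selfadj (psi a b b d)"
  unfolding selfadj_def
proof (intro conjI allI BH_I)
  show "psi a b b d (imult x) = imult (psi a b b d x)" for x
    by (simp add: psi_apply inner_imult_left algebra_simps)
  show "inner (psi a b b d x) y = inner x (psi a b b d y)" for x y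
    by (simp add: psi_apply inner_simps inner_commute algebra_simps)
qed

text \<open>Prescribing the block as the square of a symmetric matrix makes positivity automatic;
  outside the block the operator is the identity.\<close>

lemma psi_PD:
  assumes det: "p * r - q * q \<noteq> 0"
  obtains A where "A \<in> PD" "block P A (psi p q q r o\<^sub>L psi p q q r)"
proof -
  define R where "R = psi p q q r + (id_blinfun - P)"
  define D where "D = p * r - q * q"
  define R' where "R' = psi (r / D) (- q / D) (- q / D) (p / D) + (id_blinfun - P)"
  have D: "D \<noteq> 0" using det by (simp add: D_def)
  have inv: "p * r / D - q * q / D = 1" using D by (simp add: D_def diff_divide_distrib[symmetric])
  have "R o\<^sub>L R' = id_blinfun" "R' o\<^sub>L R = id_blinfun"
    using inv by (simp_all add: R_def R'_def compose_simps psi_mult algebra_simps)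
  moreover have sa: "selfadj R" "selfadj R'"
    unfolding R_def R'_def by (auto intro!: selfadj_closed psi_selfadj)
  ultimately have "R o\<^sub>L R \<in> PD"
    by (intro op_square_PD op_invertibleI[of R R'] selfadj_BH)
  moreover have "block P (R o\<^sub>L R) (psi p q q r o\<^sub>L psi p q q r)"
    by (simp add: block_def R_def compose_simps psi_mult algebra_simps)
  ultimately show thesis by (rule that)
qed

lemma psi_kubo_ando:
  assumes A: "A \<in> PD" and B: "B \<in> PD" and f: "continuous_on {0<..} f"
    and M: "block P A M" and N: "block P B N"
    and Y: "M o\<^sub>L psi a b c d = N" "k + k' = a + d" "k * k' = a * d - b * c"
    and fk: "f k = \<alpha> + \<beta> * k" "f k' = \<alpha> + \<beta> * k'"
  shows "block P (kubo_ando f A B) (\<alpha> *\<^sub>R M + \<beta> *\<^sub>R N)"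
proof (rule block_kubo_ando[OF A B f M N _ Y(1) _ _ fk])
  show "psi a b c d o\<^sub>L psi a b c d = (k + k') *\<^sub>R psi a b c d - (k * k') *\<^sub>R P"
    unfolding Y by (rule psi_cayley_hamilton)
qed (simp_all add: psi_mult)

end

text \<open>Gram-Schmidt in the realification: complex orthogonality means removing the components
  along both \<open>e1\<close> and \<open>imult e1\<close>.\<close>

lemma orthonormal_pair_exists:
  fixes x y :: "'a::chilbert"
  assumes x: "x \<noteq> 0" and y: "\<And>c. y \<noteq> cscale c x"
  obtains e1 e2 :: 'a where "orthonormal_pair e1 e2"
proof -
  define e1 where "e1 = (1 / norm x) *\<^sub>R x"
  define z where "z = y - inner y e1 *\<^sub>R e1 - inner y (imult e1) *\<^sub>R imult e1"
  have e1: "inner e1 e1 = 1" using x by (simp add: e1_def norm_eq_sqrt_inner)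
  have "z \<noteq> 0"
  proof
    assume "z = 0"
    then have "y = cscale (Complex (inner y e1 / norm x) (inner y (imult e1) / norm x)) x"
      by (simp add: z_def e1_def cscale_def algebra_simps)
    then show False using y by blast
  qed
  define e2 where "e2 = (1 / norm z) *\<^sub>R z"
  have e2: "inner e2 e2 = 1" using \<open>z \<noteq> 0\<close> by (simp add: e2_def norm_eq_sqrt_inner)
  have z: "inner z e1 = 0" "inner z (imult e1) = 0"
    using e1 by (simp_all add: z_def inner_simps inner_imult_left)
  then have "inner e1 (imult z) = 0" using inner_imult_left[of e1 z] by (simp add: inner_commute)
  then have "orthonormal_pair e1 e2"
    using e1 e2 z by unfold_locales (simp_all add: e2_def inner_commute)
  then show thesis by (rule that)
qed

section \<open>Operator monotone functions are strictly increasing\<close>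

lemma projection_compose:
  assumes "Q o\<^sub>L Q = Q"
  shows "(a *\<^sub>R id_blinfun + (b - a) *\<^sub>R Q) o\<^sub>L (c *\<^sub>R id_blinfun + (d - c) *\<^sub>R Q)
       = (a * c) *\<^sub>R id_blinfun + (b * d - a * c) *\<^sub>R Q"
  by (simp add: compose_simps assms algebra_simps)

lemma projection_PD:
  assumes Q: "selfadj Q" "Q o\<^sub>L Q = Q" and ab: "0 < a" "0 < b"
  shows "a *\<^sub>R id_blinfun + (b - a) *\<^sub>R Q \<in> PD"
proof -
  define R where "R = sqrt a *\<^sub>R id_blinfun + (sqrt b - sqrt a) *\<^sub>R Q"
  define R' where "R' = (1 / sqrt a) *\<^sub>R id_blinfun + (1 / sqrt b - 1 / sqrt a) *\<^sub>R Q"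
  have "selfadj R" "selfadj R'" unfolding R_def R'_def using Q by simp_all
  moreover have "R o\<^sub>L R' = id_blinfun" "R' o\<^sub>L R = id_blinfun"
    unfolding R_def R'_def projection_compose[OF Q(2)] using ab by simp_all
  ultimately have "R o\<^sub>L R \<in> PD"
    by (intro op_square_PD op_invertibleI[of R R'] selfadj_BH)
  moreover have "R o\<^sub>L R = a *\<^sub>R id_blinfun + (b - a) *\<^sub>R Q"
    unfolding R_def projection_compose[OF Q(2)] using ab by simp
  ultimately show ?thesis by simp
qed

lemma projection_fcalc:
  assumes Q: "selfadj Q" "Q o\<^sub>L Q = Q" and ab: "0 < a" "0 < b" and h: "continuous_on {0<..} h"
  shows "fcalc h (a *\<^sub>R id_blinfun + (b - a) *\<^sub>R Q) = h a *\<^sub>R id_blinfun + (h b - h a) *\<^sub>R Q"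
proof (rule blinfun_eqI)
  let ?A = "a *\<^sub>R id_blinfun + (b - a) *\<^sub>R Q"
  fix x
  have QQ: "Q (Q x) = Q x" using Q(2) by (metis blinfun_apply_blinfun_compose)
  have "?A (Q x) = b *\<^sub>R Q x" "?A (x - Q x) = a *\<^sub>R (x - Q x)"
    by (simp_all add: blinfun.bilinear_simps QQ algebra_simps)
  then have "fcalc h ?A (Q x) = h b *\<^sub>R Q x" "fcalc h ?A (x - Q x) = h a *\<^sub>R (x - Q x)"
    by (auto intro!: fcalc_eigenvector projection_PD Q ab h)
  moreover have "fcalc h ?A x = fcalc h ?A (Q x) + fcalc h ?A (x - Q x)"
    by (metis blinfun.add_right add.commute diff_add_cancel)
  ultimately show "fcalc h ?A x = (h a *\<^sub>R id_blinfun + (h b - h a) *\<^sub>R Q) x"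
    by (simp add: blinfun.bilinear_simps algebra_simps)
qed

lemma op_le_iff: "selfadj A \<Longrightarrow> selfadj B \<Longrightarrow> op_le A B \<longleftrightarrow> (\<forall>x. inner (A x) x \<le> inner (B x) x)"
  by (simp add: op_le_def op_positive_iff blinfun.bilinear_simps inner_simps)

lemma op_monotone_le:
  fixes x :: "'b::chilbert"
  assumes mono: "op_monotone TYPE('b) f" and x: "x \<noteq> 0" and ab: "0 < a" "a \<le> b"
  shows "f a \<le> f b"
proof -
  have f: "continuous_on {0<..} f" using mono by (simp add: op_monotone_def)
  have "op_le (a *\<^sub>R id_blinfun :: 'b \<Rightarrow>\<^sub>L 'b) (b *\<^sub>R id_blinfun)"
    using ab by (simp add: op_le_iff blinfun.bilinear_simps mult_right_mono)
  then have "op_le (fcalc f (a *\<^sub>R id_blinfun :: 'b \<Rightarrow>\<^sub>L 'b)) (fcalc f (b *\<^sub>R id_blinfun))"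
    using mono ab PD_scaleR_id[of a] PD_scaleR_id[of b] by (auto simp: op_monotone_def)
  then have "f a * inner x x \<le> f b * inner x x"
    using ab by (simp add: fcalc_scaleR_id[OF f] op_le_iff blinfun.bilinear_simps)
  then show ?thesis using x by simp
qed

context orthonormal_pair
begin

text \<open>If \<open>f\<close> takes the value \<open>f a\<close> at both \<open>a\<close> and \<open>a + \<delta>\<close>, then \<open>f\<close> of the operators \<open>A \<le> B\<close> below
  equals \<open>f a\<close> up to multiples of two different rank-one projections, and two such multiples
  are comparable only if their signs differ.\<close>

lemma op_monotone_flat_step:
  assumes mono: "op_monotone TYPE('a) f" and pos: "0 < a" "0 < b" "0 < \<delta>" and flat: "f (a + \<delta>) = f a"
  shows "f b \<le> f a" "f a \<le> f (b + \<delta>)"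
proof -
  have f: "continuous_on {0<..} f" using mono by (simp add: op_monotone_def)
  \<comment> \<open>Tilting \<open>Q\<close> by \<open>s\<close> changes the operator by at most |b
    - a| s, and this must not exceed the shift \<delta> if A \<le> B is to hold.\<close>
  define s where "s = min (1/2) (\<delta> / (\<bar>b - a\<bar> + 1))"
  have "s \<le> 1/2" unfolding s_def by (rule min.cobounded1)
  moreover have "0 < s" using pos by (simp add: s_def)
  ultimately have s: "0 < s" "s \<le> 1/2" by auto
  have sd: "\<bar>b - a\<bar> * s \<le> \<delta>"
  proof -
    have "s \<le> \<delta> / (\<bar>b - a\<bar> + 1)" by (simp add: s_def)
    then have "s * (\<bar>b - a\<bar> + 1) \<le> \<delta>" by (simp add: pos_le_divide_eq)
    then show ?thesis using s by (simp add: algebra_simps)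
  qed
  define c where "c = sqrt (1 - s * s)"
  have "s * s \<le> (1/2) * (1/2)" using s by (intro mult_mono) auto
  then have c: "c * c = 1 - s * s" by (simp add: c_def)
  define Q where "Q = psi 1 0 0 0"
  define Q' where "Q' = psi (c * c) (c * s) (c * s) (s * s)"
  have Q: "selfadj Q" "Q o\<^sub>L Q = Q" by (simp_all add: Q_def psi_selfadj psi_mult)
  have cs: "c * s * (c * s) = (1 - s * s) * (s * s)" by (simp only: c[symmetric] ac_simps)
  then have Q': "selfadj Q'" "Q' o\<^sub>L Q' = Q'"
    by (simp_all add: Q'_def psi_selfadj psi_mult psi_eq_iff c algebra_simps)
  define N where "N = Q' - Q"
  have N: "N = psi (- (s * s)) (c * s) (c * s) (s * s)"
    by (simp add: N_def Q_def Q'_def psi_diff c)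
  have saN: "selfadj N" unfolding N by (rule psi_selfadj)
  \<comment> \<open>On the plane \<open>N\<close> is \<open>s\<close> times a reflection, hence its
    norm is at most \<open>s\<close>.\<close>
  have NN: "N o\<^sub>L N = (s * s) *\<^sub>R P"
    using cs by (simp add: N psi_mult psi_scaleR psi_eq_iff c algebra_simps)
  have normN: "norm (N x) \<le> s * norm x" for x
  proof (rule power2_le_imp_le)
    have "inner (P x) (P x) = inner (P x) x"
      using selfadj_inner[OF psi_selfadj[of 1 0 1], of "P x" x] psi_mult[of 1 0 0 1 1 0 0 1]
      by (metis (no_types, lifting) add.right_neutral blinfun_apply_blinfun_compose inner_commute
          mult_1 mult_zero_left add_0)
    then have "(norm (P x))\<^sup>2 \<le> norm (P x) * norm x"
      using norm_cauchy_schwarz[of "P x" x] by (simp add: power2_norm_eq_inner)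
    then have "norm (P x) \<le> norm x"
      by (cases "P x = 0") (auto simp: power2_eq_square)
    then have "inner (P x) x \<le> norm x * norm x"
      using norm_cauchy_schwarz[of "P x" x] by (meson mult_right_mono norm_ge_zero order_trans)
    then have 1: "(s * s) * inner (P x) x \<le> (s * s) * (norm x * norm x)"
      using s by (intro mult_left_mono) auto
    have "(norm (N x))\<^sup>2 = inner ((N o\<^sub>L N) x) x"
      by (simp add: power2_norm_eq_inner selfadj_inner[OF saN])
    also have "\<dots> = (s * s) * inner (P x) x" unfolding NN by (simp add: blinfun.bilinear_simps)
    finally show "(norm (N x))\<^sup>2 \<le> (s * norm x)\<^sup>2"
      using 1 by (simp add: power2_eq_square algebra_simps)
  qed (use s in auto)
  define A where "A = a *\<^sub>R id_blinfun + (b - a) *\<^sub>R Q"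
  define B where "B = (a + \<delta>) *\<^sub>R id_blinfun + ((b + \<delta>) - (a + \<delta>)) *\<^sub>R Q'"
  have "A \<in> PD" unfolding A_def by (rule projection_PD[OF Q pos(1,2)])
  moreover have "B \<in> PD" unfolding B_def by (rule projection_PD[OF Q']) (use pos in auto)
  ultimately have PD: "A \<in> PD" "B \<in> PD" by auto
  have "inner (A x) x \<le> inner (B x) x" for x
  proof -
    have "\<bar>inner (N x) x\<bar> \<le> norm (N x) * norm x" by (rule Cauchy_Schwarz_ineq2)
    also have "\<dots> \<le> s * norm x * norm x" by (intro mult_right_mono normN) simp
    finally have "\<bar>b - a\<bar> * \<bar>inner (N x) x\<bar> \<le> \<bar>b - a\<bar> * (s * norm x * norm x)"
      by (intro mult_left_mono) auto
    also have "\<dots> = \<bar>b - a\<bar> * s * (norm x * norm x)" by simp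
    also have "\<dots> \<le> \<delta> * (norm x * norm x)" using sd by (intro mult_right_mono) auto
    finally have "\<bar>(b - a) * inner (N x) x\<bar> \<le> \<delta> * inner x x"
      by (simp add: abs_mult power2_norm_eq_inner[symmetric] power2_eq_square)
    moreover have "inner (B x) x - inner (A x) x = \<delta> * inner x x + (b - a) * inner (N x) x"
      by (simp add: A_def B_def N_def blinfun.bilinear_simps inner_simps algebra_simps)
    ultimately show ?thesis by linarith
  qed
  then have "op_le A B" using PD by (simp add: op_le_iff PD_selfadj)
  then have "op_le (fcalc f A) (fcalc f B)" using mono PD by (simp add: op_monotone_def)
  then have le: "inner (fcalc f A x) x \<le> inner (fcalc f B x) x" for x
    using PD f by (simp add: op_le_iff fcalc_selfadj)
  have fA: "fcalc f A = f a *\<^sub>R id_blinfun + (f b - f a) *\<^sub>R Q"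
    unfolding A_def by (rule projection_fcalc[OF Q pos(1,2) f])
  have fB: "fcalc f B = f a *\<^sub>R id_blinfun + (f (b + \<delta>) - f a) *\<^sub>R Q'"
    unfolding B_def using projection_fcalc[OF Q' _ _ f, of "a + \<delta>" "b + \<delta>"] pos flat by simp
  have le: "(f b - f a) * inner (Q x) x \<le> (f (b + \<delta>) - f a) * inner (Q' x) x" for x
    using le[of x] unfolding fA fB by (simp add: blinfun.bilinear_simps inner_simps)
  \<comment> \<open>This vector is orthogonal to the range of \<open>Q'\<close>, so only the
    \<open>Q\<close> term survives; below, \<open>e2\<close> likewise annihilates
    \<open>Q\<close>.\<close>
  let ?x = "(- s) *\<^sub>R e1 + c *\<^sub>R e2"
  have "inner (Q ?x) ?x = s * s" "inner (Q' ?x) ?x = 0" "0 < s * s"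
    using s by (simp_all add: Q_def Q'_def psi_apply inner_simps e_simps algebra_simps)
  then have "(f b - f a) * (s * s) \<le> 0" using le[of ?x] by simp
  then show "f b \<le> f a" using s by (auto simp: mult_le_0_iff)
  have "inner (Q e2) e2 = 0" "inner (Q' e2) e2 = s * s"
    by (simp_all add: Q_def Q'_def psi_apply inner_simps e_simps)
  then have "0 \<le> (f (b + \<delta>) - f a) * (s * s)" using le[of e2] by simp
  then show "f a \<le> f (b + \<delta>)" using \<open>0 < s * s\<close> by (simp add: zero_le_mult_iff)
qed

text \<open>Monotonicity shrinks the flat interval to a length \<delta> < b. The first inequality of
  the flat step at b and the second at b - \<delta> then pinch f b.\<close>

lemma op_monotone_flat_imp_constant:
  assumes mono: "op_monotone TYPE('a) f" and ab: "0 < a" "a < a'" and flat: "f a' = f a" and b: "0 < b"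
  shows "f b = f a"
proof -
  have "e1 \<noteq> 0" using e11 by auto
  note le = op_monotone_le[OF mono this]
  define \<delta> where "\<delta> = min (a' - a) (b / 2)"
  have \<delta>: "0 < \<delta>" "\<delta> < b" using ab b by (auto simp: \<delta>_def)
  have "f (a + \<delta>) = f a"
    using le[of a "a + \<delta>"] le[of "a + \<delta>" a'] ab \<delta> flat by (auto simp: \<delta>_def)
  from op_monotone_flat_step[OF mono ab(1) _ \<delta>(1) this, of b]
    op_monotone_flat_step[OF mono ab(1) _ \<delta>(1) this, of "b - \<delta>"]
  show ?thesis using b \<delta> by auto
qed

lemma op_monotone_strict:
  assumes mono: "op_monotone TYPE('a) f" and nonconst: "0 < b" "0 < b'" "f b \<noteq> f b'"
    and ab: "0 < a" "a < a'"
  shows "f a < f a'"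
proof -
  have "e1 \<noteq> 0" using e11 by auto
  then have "f a \<le> f a'" using op_monotone_le[OF mono] ab by auto
  moreover have "f a' \<noteq> f a"
    using op_monotone_flat_imp_constant[OF mono ab] nonconst by metis
  ultimately show ?thesis by simp
qed

end

section \<open>Consequences of associativity for two-by-two blocks\<close>

lemma positive_quadratic_roots:
  fixes r \<tau> :: real
  assumes r: "0 < r" and \<tau>: "2 * r < \<tau>"
  obtains k k' where "0 < k" "k < k'" "k + k' = \<tau>" "k * k' = r * r"
proof -
  define D where "D = sqrt (\<tau>\<^sup>2 - 4 * (r * r))"
  have "(2 * r)\<^sup>2 < \<tau>\<^sup>2" using \<tau> r by (intro power_strict_mono) auto
  then have "4 * (r * r) < \<tau>\<^sup>2" by (simp add: power2_eq_square)
  then have D: "0 < D" "D * D = \<tau>\<^sup>2 - 4 * (r * r)" by (auto simp: D_def)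
  have "D < \<tau>"
    unfolding D_def using \<tau> r by (intro real_less_lsqrt) auto
  show thesis
  proof (rule that[of "(\<tau> - D) / 2" "(\<tau> + D) / 2"])
    show "(\<tau> - D) / 2 * ((\<tau> + D) / 2) = r * r"
      using D by (simp add: algebra_simps power2_eq_square)
  qed (use D \<open>D < \<tau>\<close> in \<open>auto simp: field_simps\<close>)
qed

text \<open>The generalised eigenvalues of two matrices at a given angle. Their sum mixes the values
  for aligned and for crossed eigenbases; by the inequality of means each is at least twice the root
  of the product, and they differ, so the discriminant is positive.\<close>

lemma interlaced_roots:
  fixes a a' d d' x :: real
  assumes pos: "0 < a" "0 < a'" "0 < d" "0 < d'" and ne: "a \<noteq> a'" "d \<noteq> d'" and x: "0 < x" "x < 1"
  obtains k k' where "0 < k" "k < k'" "k + k' = x * (d / a + d' / a') + (1 - x) * (d / a' + d' / a)"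
    "k * k' = d * d' / (a * a')"
proof -
  define \<tau> where "\<tau> = x * (d / a + d' / a') + (1 - x) * (d / a' + d' / a)"
  define \<delta> where "\<delta> = d * d' / (a * a')"
  define r where "r = sqrt \<delta>"
  have \<delta>: "\<delta> > 0" using pos by (simp add: \<delta>_def)
  have r: "r > 0" "r * r = \<delta>" using \<delta> by (auto simp: r_def)
  have amgm: "2 * r \<le> u + w" if "0 < u" "0 < w" "u * w = \<delta>" for u w
  proof -
    have "(2 * r)\<^sup>2 \<le> (u + w)\<^sup>2"
      using that r zero_le_power2[of "u - w"] by (simp add: power2_eq_square algebra_simps)
    then show ?thesis using that by (meson add_pos_pos less_imp_le power2_le_imp_le)
  qed
  let ?T1 = "d / a + d' / a'" and ?T2 = "d / a' + d' / a"
  have "2 * r \<le> ?T1" "2 * r \<le> ?T2" by (intro amgm; use pos in \<open>simp add: \<delta>_def field_simps\<close>)+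
  moreover have "?T1 \<noteq> ?T2"
  proof
    assume "?T1 = ?T2"
    moreover have "(d - d') * (1 / a - 1 / a') = ?T1 - ?T2"
      by (simp add: left_diff_distrib right_diff_distrib diff_divide_distrib)
    ultimately have "(d - d') * (1 / a - 1 / a') = 0" by linarith
    then show False using ne pos by simp
  qed
  ultimately have "(2 * r < ?T1 \<and> 2 * r \<le> ?T2) \<or> (2 * r \<le> ?T1 \<and> 2 * r < ?T2)" by linarith
  then have "0 < x * (?T1 - 2 * r) + (1 - x) * (?T2 - 2 * r)"
  proof
    assume "2 * r < ?T1 \<and> 2 * r \<le> ?T2"
    then show ?thesis using x by (intro add_pos_nonneg mult_pos_pos mult_nonneg_nonneg) auto
  next
    assume "2 * r \<le> ?T1 \<and> 2 * r < ?T2"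
    then show ?thesis using x by (intro add_nonneg_pos mult_pos_pos mult_nonneg_nonneg) auto
  qed
  moreover have "x * (?T1 - 2 * r) + (1 - x) * (?T2 - 2 * r) = \<tau> - 2 * r"
    unfolding \<tau>_def by (simp add: left_diff_distrib right_diff_distrib)
  ultimately have \<tau>: "2 * r < \<tau>" by simp
  obtain k k' where "0 < k" "k < k'" "k + k' = \<tau>" "k * k' = r * r"
    using positive_quadratic_roots[OF r(1) \<tau>] .
  then show thesis using that r by (simp add: \<tau>_def \<delta>_def)
qed

context orthonormal_pair
begin

text \<open>\<open>rot x l l'\<close> has the eigenvalues \<open>l\<close> and \<open>l'\<close>, with eigenvector \<open>(sqrt x, sqrt (1 - x))\<close> for \<open>l\<close>.\<close>

definition rot :: "real \<Rightarrow> real \<Rightarrow> real \<Rightarrow> 'a \<Rightarrow>\<^sub>L 'a" where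
  "rot x l l' = psi (x * l + (1 - x) * l') (sqrt (x * (1 - x)) * (l - l'))
     (sqrt (x * (1 - x)) * (l - l')) ((1 - x) * l + x * l')"

lemma rot_mult:
  assumes "0 < x" "x < 1"
  shows "rot x l l' o\<^sub>L rot x m m' = rot x (l * m) (l' * m')"
proof -
  define y where "y = sqrt (x * (1 - x))"
  have "y * y = x * (1 - x)" using assms by (simp add: y_def)
  then have "(y * u) * (y * w) = x * (1 - x) * (u * w)" for u w by (metis mult.assoc mult.left_commute)
  then show ?thesis
    unfolding rot_def y_def[symmetric] by (simp add: psi_mult psi_eq_iff algebra_simps)
qed

lemma rot_one: "rot x 1 1 = P"
  by (simp add: rot_def)

lemma rot_affine: "p *\<^sub>R P + q *\<^sub>R rot x l l' = rot x (p + q * l) (p + q * l')"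
  by (simp add: rot_def psi_simps psi_eq_iff algebra_simps)

lemma rot_square:
  assumes "0 < x" "x < 1"
  shows "rot x l l' o\<^sub>L rot x l l' = (l + l') *\<^sub>R rot x l l' - (l * l') *\<^sub>R P"
  unfolding rot_mult[OF assms] by (simp add: rot_def psi_simps psi_eq_iff algebra_simps)

lemma rot_PD:
  assumes x: "0 < x" "x < 1" and l: "0 < l" "0 < l'"
  obtains A where "A \<in> PD" "block P A (rot x l l')"
proof -
  define p where "p = x * sqrt l + (1 - x) * sqrt l'"
  define r where "r = (1 - x) * sqrt l + x * sqrt l'"
  define q where "q = sqrt (x * (1 - x)) * (sqrt l - sqrt l')"
  have "q * q = x * (1 - x) * ((sqrt l - sqrt l') * (sqrt l - sqrt l'))"
    using x by (simp add: q_def algebra_simps)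
  then have "p * r - q * q = sqrt l * sqrt l'"
    by (simp add: p_def r_def algebra_simps)
  then have "p * r - q * q \<noteq> 0" using l by simp
  then obtain A where A: "A \<in> PD" "block P A (psi p q q r o\<^sub>L psi p q q r)" by (rule psi_PD)
  have "psi p q q r = rot x (sqrt l) (sqrt l')"
    by (simp add: rot_def p_def q_def r_def)
  then have "psi p q q r o\<^sub>L psi p q q r = rot x l l'" using l by (simp add: rot_mult[OF x])
  then show thesis using A that by simp
qed

lemma diag_PD:
  assumes c: "0 < c" "0 < c'"
  obtains C where "C \<in> PD" "block P C (psi c 0 0 c')"
proof -
  have "sqrt c * sqrt c' - 0 * 0 \<noteq> 0" using c by simp
  then obtain C where "C \<in> PD" "block P C (psi (sqrt c) 0 0 (sqrt c') o\<^sub>L psi (sqrt c) 0 0 (sqrt c'))"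
    by (rule psi_PD)
  then show thesis using c that by (simp add: psi_mult)
qed

text \<open>The quotient of the two blocks has a trace that moves with the angle parameter
  \<open>x\<close> and a determinant that does not; this is the freedom exploited later.\<close>

lemma rot_diag_kubo_ando:
  assumes A: "A \<in> PD" and C: "C \<in> PD" and f: "continuous_on {0<..} f"
    and x: "0 < x" "x < 1" and s: "0 < s" "0 < s'"
    and bA: "block P A (rot x s s')" and bC: "block P C (psi c 0 0 c')"
    and k: "k + k' = x * (c / s + c' / s') + (1 - x) * (c / s' + c' / s)" "k * k' = c * c' / (s * s')"
    and fk: "f k = \<alpha> + \<beta> * k" "f k' = \<alpha> + \<beta> * k'"
  shows "block P (kubo_ando f A C) (\<alpha> *\<^sub>R rot x s s' + \<beta> *\<^sub>R psi c 0 0 c')"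
proof -
  define y where "y = sqrt (x * (1 - x))"
  have y: "y * y = x * (1 - x)" using x by (simp add: y_def)
  define i where "i = 1 / s"
  define i' where "i' = 1 / s'"
  have "rot x s s' o\<^sub>L (rot x i i' o\<^sub>L psi c 0 0 c') = psi c 0 0 c'"
    unfolding compose_assoc[symmetric] rot_mult[OF x]
    using s by (simp add: i_def i'_def rot_one psi_mult)
  moreover have "rot x i i' o\<^sub>L psi c 0 0 c' = psi ((x * i + (1 - x) * i') * c) (y * (i - i') * c')
      (y * (i - i') * c) (((1 - x) * i + x * i') * c')"
    by (simp add: rot_def psi_mult y_def)
  ultimately have Y: "rot x s s' o\<^sub>L psi ((x * i + (1 - x) * i') * c) (y * (i - i') * c')
      (y * (i - i') * c) (((1 - x) * i + x * i') * c') = psi c 0 0 c'" by simp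
  have det: "k * k' = (x * i + (1 - x) * i') * c * (((1 - x) * i + x * i') * c') - y * (i - i') * c' * (y * (i - i') * c)"
  proof -
    have "y * (i - i') * c' * (y * (i - i') * c) = (y * y) * ((i - i') * (i - i') * c * c')"
      by (simp add: algebra_simps)
    moreover have "k * k' = i * i' * c * c'" by (simp add: k i_def i'_def)
    ultimately show ?thesis unfolding y by (simp add: algebra_simps)
  qed
  show ?thesis
    by (rule psi_kubo_ando[OF A C f bA bC Y _ det fk]) (simp add: k i_def i'_def algebra_simps)
qed

end

section \<open>Associativity with a scalar in the middle\<close>

locale associative_mean = orthonormal_pair e1 e2 for e1 e2 :: "'a::chilbert" +
  fixes f g :: "real \<Rightarrow> real"
  assumes f_cont: "continuous_on {0<..} f"
    and f_pos: "\<And>t. 0 < t \<Longrightarrow> 0 < f t"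
    and f_strict: "\<And>s t. 0 < s \<Longrightarrow> s < t \<Longrightarrow> f s < f t"
    and f_one: "f 1 = 1"
    and f_sym: "\<And>t. 0 < t \<Longrightarrow> t * f (1 / t) = f t"
    and g_cont: "continuous_on {0<..} g"
    and g_mono: "strict_mono_on {0<..} g"
    and g_surj: "g ` {0<..} = {0<..}"
    and assoc: "\<And>A B C. A \<in> (PD :: ('a \<Rightarrow>\<^sub>L 'a) set) \<Longrightarrow> B \<in> PD \<Longrightarrow> C \<in> PD \<Longrightarrow>
       fcalc g (kubo_ando f (fcalc g (kubo_ando f A B)) C)
       = fcalc g (kubo_ando f A (fcalc g (kubo_ando f B C)))"
begin

lemma g_pos: "0 < t \<Longrightarrow> 0 < g t"
  using g_surj by auto

lemma mean_PD: "A \<in> PD \<Longrightarrow> B \<in> PD \<Longrightarrow> kubo_ando f A B \<in> PD"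
  by (intro kubo_ando_PD f_cont f_pos)

lemma op_PD: "A \<in> PD \<Longrightarrow> B \<in> PD \<Longrightarrow> fcalc g (kubo_ando f A B) \<in> PD"
  by (intro fcalc_PD mean_PD g_cont g_pos)

lemma assoc_mean:
  assumes "A \<in> (PD :: ('a \<Rightarrow>\<^sub>L 'a) set)" "B \<in> PD" "C \<in> PD"
  shows "kubo_ando f (fcalc g (kubo_ando f A B)) C = kubo_ando f A (fcalc g (kubo_ando f B C))"
  by (rule fcalc_inj[OF _ _ g_cont g_mono g_surj assoc[OF assms]])
    (intro mean_PD op_PD assms)+

text \<open>The product of the scalars \<open>t\<close> and \<open>x\<close> under the operation; as
  an operator function, \<open>h t\<close> is the product with the scalar \<open>t\<close>, from
  either side.\<close>

definition h :: "real \<Rightarrow> real \<Rightarrow> real" where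
  "h t x = g (t * f (x / t))"

lemma h_pos: "0 < t \<Longrightarrow> 0 < x \<Longrightarrow> 0 < h t x"
  by (simp add: h_def g_pos f_pos)

lemma h_strict: "0 < t \<Longrightarrow> 0 < x \<Longrightarrow> x < y \<Longrightarrow> h t x < h t y"
  unfolding h_def using g_mono
  by (auto intro!: strict_mono_onD[OF g_mono] mult_pos_pos f_pos mult_strict_left_mono f_strict divide_strict_right_mono)

lemma mean_sym: "0 < t \<Longrightarrow> 0 < x \<Longrightarrow> t * f (x / t) = x * f (t / x)"
  using f_sym[of "x / t"] by (simp add: field_simps)

text \<open>The mean with \<open>t\<close> is affine in \<open>N\<close>, with coefficients
  interpolating t f(x / t), and \<open>g\<close> is then interpolated at the two values of the mean.
  By symmetry of \<open>f\<close> both orders agree: exchanging the factors inverts x / t and swaps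
  the two coefficients up to scaling by t.\<close>

lemma scalar_op_block:
  assumes A: "A \<in> PD" and N: "block P A N" "N o\<^sub>L N = (a + a') *\<^sub>R N - (a * a') *\<^sub>R P"
    and pos: "0 < t" "0 < a" "0 < a'" and ne: "a \<noteq> a'"
    and hp: "h t a = p + q * a" "h t a' = p + q * a'"
  shows "block P (fcalc g (kubo_ando f A (t *\<^sub>R id_blinfun))) (p *\<^sub>R P + q *\<^sub>R N)"
    and "block P (fcalc g (kubo_ando f (t *\<^sub>R id_blinfun) A)) (p *\<^sub>R P + q *\<^sub>R N)"
proof -
  define m where "m x = t * f (x / t)" for x
  define \<beta> where "\<beta> = (m a - m a') / (a - a')"
  define \<alpha> where "\<alpha> = m a - \<beta> * a"
  have m: "m a = \<alpha> + \<beta> * a" by (simp add: \<alpha>_def)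
  have "\<beta> * (a - a') = m a - m a'" using ne by (simp add: \<beta>_def)
  then have m': "m a' = \<alpha> + \<beta> * a'" by (simp add: \<alpha>_def algebra_simps)
  have "a / t < a' / t \<or> a' / t < a / t" using ne pos by (auto simp: divide_less_cancel)
  then have "f (a / t) \<noteq> f (a' / t)"
    using f_strict[of "a / t" "a' / t"] f_strict[of "a' / t" "a / t"] pos by auto
  \<comment> \<open>Strict monotonicity of \<open>f\<close> keeps the eigenvalues of the mean apart,
    so that an affine function of \<open>N\<close> can be rewritten as one of the mean.\<close>
  then have "\<beta> \<noteq> 0" using pos ne by (simp add: \<beta>_def m_def)
  have PP: "P o\<^sub>L P = P" by (simp add: psi_mult)
  have AP: "A o\<^sub>L P = N" "P o\<^sub>L A = N" using N by (auto simp: block_def)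
  have NP: "N o\<^sub>L P = N" "P o\<^sub>L N = N" using AP PP by (metis compose_assoc)+
  have T: "t *\<^sub>R id_blinfun \<in> PD" using pos by (simp add: PD_scaleR_id)
  \<comment> \<open>\<open>Z\<close> is the adjugate of \<open>N\<close>, so \<open>Y\<close> is the
    block of t times the inverse of \<open>A\<close>.\<close>
  define Z where "Z = (a + a') *\<^sub>R P - N"
  define w where "w = t / (a * a')"
  define Y where "Y = w *\<^sub>R Z"
  have "block P (kubo_ando f A (t *\<^sub>R id_blinfun)) (\<beta> *\<^sub>R N + (\<alpha> / t) *\<^sub>R (t *\<^sub>R P))"
  proof (rule block_kubo_ando[OF A T f_cont N(1) block_scaleR_id PP, of Y "t / a" "t / a'"])
    show "N o\<^sub>L Y = t *\<^sub>R P" "P o\<^sub>L Y = Y"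
      using pos by (simp_all add: Y_def Z_def w_def compose_simps NP N(2) PP)
    have "Z o\<^sub>L Z = (a + a') *\<^sub>R Z - (a * a') *\<^sub>R P"
      by (simp add: Z_def compose_simps NP N(2) PP algebra_simps)
    then have "Y o\<^sub>L Y = w *\<^sub>R w *\<^sub>R ((a + a') *\<^sub>R Z - (a * a') *\<^sub>R P)"
      by (simp only: Y_def compose_simps(5,6))
    also have "\<dots> = (w * (a + a')) *\<^sub>R Y - (w * w * (a * a')) *\<^sub>R P"
      by (simp add: Y_def scaleR_diff_right ac_simps)
    also have "w * (a + a') = t / a + t / a'" using pos by (simp add: w_def field_simps)
    also have "w * w * (a * a') = t / a * (t / a')" using pos by (simp add: w_def field_simps)
    finally show "Y o\<^sub>L Y = (t / a + t / a') *\<^sub>R Y - (t / a * (t / a')) *\<^sub>R P" .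
    show "f (t / a) = \<beta> + \<alpha> / t * (t / a)" "f (t / a') = \<beta> + \<alpha> / t * (t / a')"
      using m m' pos mean_sym[of t a] mean_sym[of t a'] by (simp_all add: m_def field_simps)
  qed
  then have 1: "block P (kubo_ando f A (t *\<^sub>R id_blinfun)) (\<alpha> *\<^sub>R P + \<beta> *\<^sub>R N)"
    using pos by (simp add: add.commute)
  have "block P (kubo_ando f (t *\<^sub>R id_blinfun) A) ((\<alpha> / t) *\<^sub>R (t *\<^sub>R P) + \<beta> *\<^sub>R N)"
  proof (rule block_kubo_ando[OF T A f_cont block_scaleR_id N(1) PP, of "(1 / t) *\<^sub>R N" "a / t" "a' / t"])
    show "t *\<^sub>R P o\<^sub>L (1 / t) *\<^sub>R N = N" "P o\<^sub>L (1 / t) *\<^sub>R N = (1 / t) *\<^sub>R N"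
      using pos by (simp_all add: compose_simps NP)
    show "(1 / t) *\<^sub>R N o\<^sub>L (1 / t) *\<^sub>R N = (a / t + a' / t) *\<^sub>R (1 / t) *\<^sub>R N - (a / t * (a' / t)) *\<^sub>R P"
      using pos by (simp add: compose_simps N(2) scaleR_diff_right add_divide_distrib)
    show "f (a / t) = \<alpha> / t + \<beta> * (a / t)" "f (a' / t) = \<alpha> / t + \<beta> * (a' / t)"
      using m m' pos by (simp_all add: m_def field_simps)
  qed
  then have 2: "block P (kubo_ando f (t *\<^sub>R id_blinfun) A) (\<alpha> *\<^sub>R P + \<beta> *\<^sub>R N)"
    using pos by simp
  have gZ: "block P (fcalc g Z) (p *\<^sub>R P + q *\<^sub>R N)"
    if Z: "Z \<in> PD" "block P Z (\<alpha> *\<^sub>R P + \<beta> *\<^sub>R N)" for Z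
  proof -
    define V where "V = \<alpha> *\<^sub>R P + \<beta> *\<^sub>R N"
    define \<mu> where "\<mu> = \<alpha> + \<beta> * a"
    define \<mu>' where "\<mu>' = \<alpha> + \<beta> * a'"
    have VP: "V o\<^sub>L P = V" "P o\<^sub>L V = V" by (simp_all add: V_def compose_simps NP PP)
    have "(N - a *\<^sub>R P) o\<^sub>L (N - a' *\<^sub>R P) = 0"
      by (simp add: compose_simps NP PP N(2) algebra_simps)
    moreover have "V - \<mu> *\<^sub>R P = \<beta> *\<^sub>R (N - a *\<^sub>R P)" "V - \<mu>' *\<^sub>R P = \<beta> *\<^sub>R (N - a' *\<^sub>R P)"
      by (simp_all add: V_def \<mu>_def \<mu>'_def algebra_simps)
    ultimately have "(V - \<mu> *\<^sub>R P) o\<^sub>L (V - \<mu>' *\<^sub>R P) = 0"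
      by (simp only: compose_simps(5,6) scaleR_zero_right)
    then have "V o\<^sub>L V = (\<mu> + \<mu>') *\<^sub>R V - (\<mu> * \<mu>') *\<^sub>R P"
      by (simp add: compose_simps VP PP algebra_simps)
    then have "(\<alpha> *\<^sub>R P + \<beta> *\<^sub>R N) o\<^sub>L (\<alpha> *\<^sub>R P + \<beta> *\<^sub>R N)
       = ((\<alpha> + \<beta> * a) + (\<alpha> + \<beta> * a')) *\<^sub>R (\<alpha> *\<^sub>R P + \<beta> *\<^sub>R N) - ((\<alpha> + \<beta> * a) * (\<alpha> + \<beta> * a')) *\<^sub>R P"
      by (simp only: V_def \<mu>_def \<mu>'_def)
    then have "block P (fcalc g Z) ((p - q / \<beta> * \<alpha>) *\<^sub>R P + (q / \<beta>) *\<^sub>R (\<alpha> *\<^sub>R P + \<beta> *\<^sub>R N))"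
      using hp \<open>\<beta> \<noteq> 0\<close>
      by (intro block_fcalc[OF Z(1) g_cont Z(2) _ PP, of "\<alpha> + \<beta> * a" "\<alpha> + \<beta> * a'"])
        (auto simp: h_def m_def[symmetric] m m' field_simps)
    then show ?thesis using \<open>\<beta> \<noteq> 0\<close> by (simp add: algebra_simps)
  qed
  show "block P (fcalc g (kubo_ando f A (t *\<^sub>R id_blinfun))) (p *\<^sub>R P + q *\<^sub>R N)"
    by (rule gZ[OF mean_PD[OF A T] 1])
  show "block P (fcalc g (kubo_ando f (t *\<^sub>R id_blinfun) A)) (p *\<^sub>R P + q *\<^sub>R N)"
    by (rule gZ[OF mean_PD[OF T A] 2])
qed

text \<open>Both sides of the law combine \<open>P\<close> and the two blocks, which are linearly
  independent since 0 < x < 1. The rotated block gives \<alpha>' = \<alpha> q, the diagonal one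
  \<beta> = \<beta>' v, and \<open>P\<close> gives \<alpha> p = \<beta>' u; multiplying by v
  eliminates \<beta>'.\<close>

lemma intercept_identity:
  assumes pos: "0 < t" "0 < a" "0 < a'" "0 < c" "0 < c'" and ne: "a \<noteq> a'" "c \<noteq> c'"
    and x: "0 < x" "x < 1"
    and hp: "h t a = p + q * a" "h t a' = p + q * a'"
    and hu: "h t c = u + v * c" "h t c' = u + v * c'"
    and k: "k + k' = x * (c / h t a + c' / h t a') + (1 - x) * (c / h t a' + c' / h t a)"
      "k * k' = c * c' / (h t a * h t a')"
    and fk: "f k = \<alpha> + \<beta> * k" "f k' = \<alpha> + \<beta> * k'"
  shows "\<alpha> * p * v = \<beta> * u"
proof -
  obtain A where A: "A \<in> PD" "block P A (rot x a a')" using rot_PD[OF x pos(2,3)] .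
  obtain C where C: "C \<in> PD" "block P C (psi c 0 0 c')" using diag_PD[OF pos(4,5)] .
  let ?T = "t *\<^sub>R id_blinfun :: 'a \<Rightarrow>\<^sub>L 'a"
  have T: "?T \<in> PD" using pos by (simp add: PD_scaleR_id)
  have "block P (fcalc g (kubo_ando f A ?T)) (p *\<^sub>R P + q *\<^sub>R rot x a a')"
    by (rule scalar_op_block(1)[OF A rot_square[OF x] pos(1-3) ne(1) hp])
  then have 1: "block P (fcalc g (kubo_ando f A ?T)) (rot x (h t a) (h t a'))"
    by (simp add: rot_affine hp)
  have "psi c 0 0 c' o\<^sub>L psi c 0 0 c' = (c + c') *\<^sub>R psi c 0 0 c' - (c * c') *\<^sub>R P"
    using psi_cayley_hamilton[of c 0 0 c'] by simp
  then have "block P (fcalc g (kubo_ando f ?T C)) (u *\<^sub>R P + v *\<^sub>R psi c 0 0 c')"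
    by (rule scalar_op_block(2)[OF C _ pos(1,4,5) ne(2) hu])
  then have 2: "block P (fcalc g (kubo_ando f ?T C)) (psi (h t c) 0 0 (h t c'))"
    by (simp add: psi_simps hu)
  have L: "block P (kubo_ando f (fcalc g (kubo_ando f A ?T)) C) (\<alpha> *\<^sub>R rot x (h t a) (h t a') + \<beta> *\<^sub>R psi c 0 0 c')"
    using pos by (intro rot_diag_kubo_ando[OF op_PD[OF A(1) T] C(1) f_cont x _ _ 1 C(2) k fk] h_pos)
  have "h t c \<noteq> h t c'" using h_strict[of t c c'] h_strict[of t c' c] pos ne by linarith
  then obtain j j' where j: "0 < j" "j < j'"
    "j + j' = x * (h t c / a + h t c' / a') + (1 - x) * (h t c / a' + h t c' / a)"
    "j * j' = h t c * h t c' / (a * a')"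
    using interlaced_roots[of a a' "h t c" "h t c'" x] pos ne x h_pos by metis
  define \<beta>' where "\<beta>' = (f j' - f j) / (j' - j)"
  define \<alpha>' where "\<alpha>' = f j - \<beta>' * j"
  have "\<beta>' * (j' - j) = f j' - f j" using j by (simp add: \<beta>'_def)
  then have fj: "f j = \<alpha>' + \<beta>' * j" "f j' = \<alpha>' + \<beta>' * j'"
    by (simp_all add: \<alpha>'_def algebra_simps)
  have R: "block P (kubo_ando f A (fcalc g (kubo_ando f ?T C))) (\<alpha>' *\<^sub>R rot x a a' + \<beta>' *\<^sub>R psi (h t c) 0 0 (h t c'))"
    by (rule rot_diag_kubo_ando[OF A(1) op_PD[OF T C(1)] f_cont x pos(2,3) A(2) 2 j(3,4) fj])
  define y where "y = sqrt (x * (1 - x))"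
  have y: "y \<noteq> 0" using x by (simp add: y_def)
  have "\<alpha> *\<^sub>R rot x (h t a) (h t a') + \<beta> *\<^sub>R psi c 0 0 c' = \<alpha>' *\<^sub>R rot x a a' + \<beta>' *\<^sub>R psi (h t c) 0 0 (h t c')"
    using L R assoc_mean[OF A(1) T C(1)] block_unique by metis
  then have eqs: "\<alpha> * (x * h t a + (1 - x) * h t a') + \<beta> * c = \<alpha>' * (x * a + (1 - x) * a') + \<beta>' * h t c"
    "\<alpha> * (y * (h t a - h t a')) = \<alpha>' * (y * (a - a'))"
    "\<alpha> * ((1 - x) * h t a + x * h t a') + \<beta> * c' = \<alpha>' * ((1 - x) * a + x * a') + \<beta>' * h t c'"
    unfolding rot_def psi_simps psi_eq_iff y_def by auto
  \<comment> \<open>Off-diagonal entries see only the rotated block; \<open>y\<close> is nonzero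
    because the eigenbases are neither aligned nor crossed.\<close>
  have "(\<alpha> * q - \<alpha>') * (y * (a - a')) = 0"
    using eqs(2) unfolding hp by (simp add: algebra_simps)
  then have \<alpha>': "\<alpha>' = \<alpha> * q" using y ne by simp
  have e1: "\<alpha> * p + \<beta> * c = \<beta>' * (u + v * c)" "\<alpha> * p + \<beta> * c' = \<beta>' * (u + v * c')"
    using eqs(1,3) unfolding hp hu \<alpha>' by (simp_all add: algebra_simps)
  then have "(\<beta> - \<beta>' * v) * (c - c') = 0" by (simp add: algebra_simps)
  then have "\<beta> = \<beta>' * v" using ne by simp
  then show ?thesis using e1(1) by (simp add: algebra_simps)
qed

end

context associative_mean
begin

section \<open>The geometric mean is excluded\<close>

text \<open>For the square root, trace and determinant already give the coefficients:
  \<open>r\<close> is sqrt k sqrt k' and \<open>w\<close> is sqrt k + sqrt k', so sqrt k = (r + k) /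
  w. This keeps the counterexample below computable.\<close>

lemma psi_geometric:
  assumes fs: "\<And>t. 0 < t \<Longrightarrow> f t = sqrt t"
    and A: "A \<in> PD" "block P A M" and B: "B \<in> PD" "block P B N"
    and Y: "M o\<^sub>L psi a b c d = N"
    and r: "0 < r" "r * r = a * d - b * c" "2 * r < a + d" and w: "0 < w" "w * w = a + d + 2 * r"
  shows "block P (kubo_ando f A B) ((r / w) *\<^sub>R M + (1 / w) *\<^sub>R N)"
proof -
  obtain k k' where k: "0 < k" "k < k'" "k + k' = a + d" "k * k' = r * r"
    using positive_quadratic_roots[OF r(1,3)] .
  have "sqrt k * sqrt k' = sqrt (r * r)" unfolding k(4)[symmetric] by (simp only: real_sqrt_mult)
  then have rk: "sqrt k * sqrt k' = r" using r(1) by simp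
  have "(sqrt k + sqrt k')\<^sup>2 = w\<^sup>2"
    using k w rk by (simp add: power2_eq_square algebra_simps)
  then have wk: "w = sqrt k + sqrt k'" using w k by (simp add: power2_eq_iff_nonneg)
  have "sqrt k * w = r + k" "sqrt k' * w = r + k'"
    using k rk by (simp_all add: wk algebra_simps)
  then have "f k = r / w + 1 / w * k" "f k' = r / w + 1 / w * k'"
    using k w by (simp_all add: fs field_simps)
  then show ?thesis
    using k r by (intro psi_kubo_ando[OF A(1) B(1) f_cont A(2) B(2) Y, of k k']) simp_all
qed

text \<open>The blocks of A and B are inverse to each other, so their geometric mean is
  \<open>P\<close>, and its square combined with the diagonal C stays diagonal. On the other side C
  does not commute with B, and an off-diagonal entry survives.\<close>

lemma geometric_mean_not_associative:
  assumes fs: "\<And>t. 0 < t \<Longrightarrow> f t = sqrt t" and gk: "\<And>t. 0 < t \<Longrightarrow> g t = k * t\<^sup>2" and k: "0 < k"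
  shows False
proof -
  have sq: "block P (fcalc g Z) (k *\<^sub>R (M o\<^sub>L M))" if Z: "Z \<in> PD" "block P Z M" for Z M
  proof -
    have "fcalc g Z = fcalc (poly [:0, 0, k:]) Z"
      by (rule fcalc_cong[OF Z(1)]) (simp add: gk power2_eq_square)
    then have gZ: "fcalc g Z = k *\<^sub>R (Z o\<^sub>L Z)" by (simp add: fcalc_poly[OF Z(1)] compose_simps)
    have ZP: "Z o\<^sub>L P = M" "P o\<^sub>L Z = M" "P o\<^sub>L P = P" using Z by (auto simp: block_def psi_mult)
    then have "Z o\<^sub>L Z o\<^sub>L P = M o\<^sub>L M" "P o\<^sub>L (Z o\<^sub>L Z) = M o\<^sub>L M" by (metis compose_assoc)+
    then show ?thesis by (simp add: gZ block_def compose_simps)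
  qed
  \<comment> \<open>\<open>psi_PD\<close> takes symmetric square roots; these two, of determinant
    -1, square to mutually inverse integer matrices.\<close>
  have "0 * (-1) - 1 * 1 \<noteq> (0::real)" "1 * 0 - 1 * 1 \<noteq> (0::real)" by simp_all
  then obtain A B where A: "A \<in> PD" "block P A (psi 0 1 1 (-1) o\<^sub>L psi 0 1 1 (-1))"
    and B: "B \<in> PD" "block P B (psi 1 1 1 0 o\<^sub>L psi 1 1 1 0)"
    using psi_PD by metis
  have A2: "block P A (psi 1 (-1) (-1) 2)" using A(2) by (simp add: psi_mult)
  have B2: "block P B (psi 2 1 1 1)" using B(2) by (simp add: psi_mult)
  obtain C where C: "C \<in> PD" "block P C (psi 4 0 0 (1/4))" using diag_PD[of 4 "1/4"] by auto
  have "block P (kubo_ando f A B) ((1 / 3) *\<^sub>R psi 1 (-1) (-1) 2 + (1 / 3) *\<^sub>R psi 2 1 1 1)"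
    by (rule psi_geometric[OF fs A(1) A2 B(1) B2, of 5 3 3 2]) (simp_all add: psi_mult)
  then have "block P (kubo_ando f A B) P" by (simp add: psi_simps)
  from sq[OF mean_PD[OF A(1) B(1)] this]
  have AB: "block P (fcalc g (kubo_ando f A B)) (psi k 0 0 k)" by (simp add: psi_simps)
  define w where "w = 5 / (2 * sqrt k)"
  have w: "0 < w" "w * w = 4 / k + 1 / (4 * k) + 2 * (1 / k)"
    using k by (simp_all add: w_def field_simps)
  have L: "block P (kubo_ando f (fcalc g (kubo_ando f A B)) C) ((1 / k / w) *\<^sub>R psi k 0 0 k + (1 / w) *\<^sub>R psi 4 0 0 (1/4))"
    by (rule psi_geometric[OF fs op_PD[OF A(1) B(1)] AB C, of "4 / k" 0 0 "1 / (4 * k)"])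
      (use k w in \<open>simp_all add: psi_mult field_simps\<close>)
  define z where "z = sqrt (13 / 2)"
  have z: "0 < z" "z * z = 13 / 2" by (simp_all add: z_def)
  have "block P (kubo_ando f B C) ((1 / z) *\<^sub>R psi 2 1 1 1 + (1 / z) *\<^sub>R psi 4 0 0 (1/4))"
    by (rule psi_geometric[OF fs B(1) B2 C, of 4 "-1/4" "-4" "1/2"])
      (use z in \<open>simp_all add: psi_mult\<close>)
  then have "block P (kubo_ando f B C) ((1 / z) *\<^sub>R psi 6 1 1 (5/4))"
    by (simp add: psi_add scaleR_add_right[symmetric])
  from sq[OF mean_PD[OF B(1) C(1)] this]
  have "block P (fcalc g (kubo_ando f B C)) ((k * (1 / (z * z))) *\<^sub>R psi 37 (29/4) (29/4) (41/16))"
    by (simp add: compose_simps psi_mult)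
  then have BC: "block P (fcalc g (kubo_ando f B C)) ((2 * k / 13) *\<^sub>R psi 37 (29/4) (29/4) (41/16))"
    by (simp add: z field_simps)
  \<comment> \<open>The root of the trace plus twice the root of the determinant of the quotient of
    the two blocks; that determinant is k^2.\<close>
  define v where "v = sqrt (1665 / 104 * k)"
  have v: "0 < v" "v * v = 1665 / 104 * k" using k by (simp_all add: v_def)
  have R: "block P (kubo_ando f A (fcalc g (kubo_ando f B C)))
      ((k / v) *\<^sub>R psi 1 (-1) (-1) 2 + (1 / v) *\<^sub>R (2 * k / 13) *\<^sub>R psi 37 (29/4) (29/4) (41/16))"
    by (rule psi_geometric[OF fs A(1) A2 op_PD[OF B(1) C(1)] BC, of "2 * k / 13 * (325/4)" "2 * k / 13 * (273/16)"
          "2 * k / 13 * (177/4)" "2 * k / 13 * (157/16)"])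
      (use k v in \<open>simp_all add: psi_simps psi_eq_iff field_simps\<close>)
  have "(1 / k / w) *\<^sub>R psi k 0 0 k + (1 / w) *\<^sub>R psi 4 0 0 (1/4)
      = (k / v) *\<^sub>R psi 1 (-1) (-1) 2 + (1 / v) *\<^sub>R (2 * k / 13) *\<^sub>R psi 37 (29/4) (29/4) (41/16)"
    using L R assoc_mean[OF A(1) B(1) C(1)] block_unique by metis
  then have "k / v * (- 1) + 1 / v * (2 * k / 13 * (29/4)) = 0"
    unfolding psi_simps psi_eq_iff by simp
  then show False using k v by (simp add: field_simps)
qed

end

section \<open>The functional equation\<close>

definition chord_slope :: "(real \<Rightarrow> real) \<Rightarrow> real \<Rightarrow> real \<Rightarrow> real" where
  "chord_slope F a b = (F b - F a) / (b - a)"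

definition chord_icpt :: "(real \<Rightarrow> real) \<Rightarrow> real \<Rightarrow> real \<Rightarrow> real" where
  "chord_icpt F a b = (b * F a - a * F b) / (b - a)"

lemma chord:
  assumes "a \<noteq> b"
  shows "F a = chord_icpt F a b + chord_slope F a b * a" "F b = chord_icpt F a b + chord_slope F a b * b"
proof -
  have "chord_icpt F a b + chord_slope F a b * a = ((b - a) * F a) / (b - a)"
    "chord_icpt F a b + chord_slope F a b * b = ((b - a) * F b) / (b - a)"
    unfolding chord_icpt_def chord_slope_def by (simp_all add: add_divide_distrib[symmetric] algebra_simps)
  then show "F a = chord_icpt F a b + chord_slope F a b * a" "F b = chord_icpt F a b + chord_slope F a b * b"
    using assms by simp_all
qed

lemma add_inverse_strict_mono:
  fixes u v :: real
  assumes "1 \<le> u" "u < v"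
  shows "u + 1 / u < v + 1 / v"
proof -
  have "1 * v \<le> u * v" using assms by (intro mult_right_mono) auto
  then have uv: "1 < u * v" using assms by linarith
  have "v + 1 / v - (u + 1 / u) = (v - u) * (1 - 1 / (u * v))"
    using assms by (simp add: field_simps)
  also have "\<dots> > 0" using assms uv by simp
  finally show ?thesis by simp
qed

context associative_mean
begin

definition ratio :: "real \<Rightarrow> real \<Rightarrow> real" where
  "ratio k k' = chord_icpt f k k' / chord_slope f k k'"

text \<open>The intercept is positive because f(t) / t = f(1 / t) is strictly decreasing.\<close>

lemma chord_f_pos:
  assumes "0 < k" "k < k'"
  shows "0 < chord_slope f k k'" "0 < chord_icpt f k k'"
proof -
  show "0 < chord_slope f k k'" using f_strict[OF assms] assms by (simp add: chord_slope_def)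
  have "f (1 / k') < f (1 / k)" using assms by (intro f_strict) (auto simp: field_simps)
  then have "k * k' * f (1 / k') < k * k' * f (1 / k)" using assms by (intro mult_strict_left_mono) auto
  then have "k * (k' * f (1 / k')) < k' * (k * f (1 / k))" by (simp only: ac_simps)
  then have "k * f k' < k' * f k" using f_sym[of k] f_sym[of k'] assms by simp
  then show "0 < chord_icpt f k k'" using assms by (simp add: chord_icpt_def)
qed

lemma ratio_pos: "0 < k \<Longrightarrow> k < k' \<Longrightarrow> 0 < ratio k k'"
  by (simp add: ratio_def chord_f_pos)

lemma ratio_mult:
  assumes "0 < k" "k < k'"
  shows "ratio k k' * (f k' - f k) = k' * f k - k * f k'"
  using f_strict[OF assms] assms by (simp add: ratio_def chord_icpt_def chord_slope_def)

lemma ratio_identity: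
  assumes pos: "0 < t" "0 < a" "0 < a'" "0 < c" "0 < c'" and ne: "a \<noteq> a'" "c \<noteq> c'"
    and x: "0 < x" "x < 1" and kk: "0 < k" "k < k'"
    and k: "k + k' = x * (c / h t a + c' / h t a') + (1 - x) * (c / h t a' + c' / h t a)"
      "k * k' = c * c' / (h t a * h t a')"
  shows "ratio k k' * chord_icpt (h t) a a' * chord_slope (h t) c c' = chord_icpt (h t) c c'"
proof -
  have "k \<noteq> k'" using kk by simp
  from intercept_identity[OF pos ne x chord[OF ne(1)] chord[OF ne(2)] k chord[OF this]]
  show ?thesis using chord_f_pos[OF kk] by (simp add: ratio_def field_simps)
qed

lemma h_continuous:
  assumes "0 < t"
  shows "continuous_on {0<..} (h t)"
  unfolding h_def
proof (rule continuous_on_compose2[OF g_cont])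
  have "continuous_on {0<..} (\<lambda>x. x / t)" using assms by (intro continuous_intros) auto
  then have "continuous_on {0<..} (\<lambda>x. f (x / t))"
    by (rule continuous_on_compose2[OF f_cont]) (use assms in auto)
  then show "continuous_on {0<..} (\<lambda>x. t * f (x / t))" by (rule continuous_on_mult_left)
  show "(\<lambda>x. t * f (x / t)) ` {0<..} \<subseteq> {0<..}"
    using assms by (intro image_subsetI) (simp add: f_pos)
qed

lemma chord_slope_h_pos:
  assumes "0 < t" "0 < c" "c < c'"
  shows "0 < chord_slope (h t) c c'"
  using h_strict[OF assms] assms by (simp add: chord_slope_def)

text \<open>A normal form: among the pairs with product \<pi> one is picked, and
  \<open>ratio_product\<close> shows that the choice is immaterial.\<close>

definition \<Phi> :: "real \<Rightarrow> real" where
  "\<Phi> \<pi> = ratio (sqrt \<pi> / 2) (sqrt \<pi> * 2)"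

lemma \<Phi>_pos: "0 < \<pi> \<Longrightarrow> 0 < \<Phi> \<pi>"
  unfolding \<Phi>_def by (intro ratio_pos) auto

lemma scalar_mean:
  assumes "0 < a" "0 < b"
  shows "kubo_ando f (a *\<^sub>R id_blinfun) (b *\<^sub>R id_blinfun) = (a * f (b / a)) *\<^sub>R id_blinfun"
proof -
  have "(1 / sqrt a) * b * (1 / sqrt a) = b / a" "sqrt a * f (b / a) * sqrt a = a * f (b / a)"
    using assms by (simp_all add: field_simps)
  then show ?thesis
    unfolding kubo_ando_def using assms
    by (simp add: fcalc_scaleR_id[OF continuous_on_sqrt_pos] fcalc_scaleR_id[OF continuous_on_inverse_sqrt]
        compose_simps fcalc_scaleR_id[OF f_cont] ac_simps)
qed

lemma scalar_assoc:
  assumes "0 < a" "0 < b" "0 < c"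
  shows "h a b * f (c / h a b) = a * f (h b c / a)"
proof -
  let ?I = "id_blinfun :: 'a \<Rightarrow>\<^sub>L 'a"
  have g: "fcalc g (kubo_ando f (s *\<^sub>R ?I) (t *\<^sub>R ?I)) = h s t *\<^sub>R ?I" if "0 < s" "0 < t" for s t
    using that by (simp add: scalar_mean fcalc_scaleR_id[OF g_cont] f_pos h_def)
  have "kubo_ando f (h a b *\<^sub>R ?I) (c *\<^sub>R ?I) = kubo_ando f (a *\<^sub>R ?I) (h b c *\<^sub>R ?I)"
    using assoc_mean[OF PD_scaleR_id PD_scaleR_id PD_scaleR_id, OF assms]
    unfolding g[OF assms(1,2)] g[OF assms(2,3)] .
  then have "(h a b * f (c / h a b)) *\<^sub>R ?I = (a * f (h b c / a)) *\<^sub>R ?I"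
    unfolding scalar_mean[OF h_pos[OF assms(1,2)] assms(3)] scalar_mean[OF assms(1) h_pos[OF assms(2,3)]] .
  then have "((h a b * f (c / h a b)) *\<^sub>R ?I) e1 = ((a * f (h b c / a)) *\<^sub>R ?I) e1" by (simp only:)
  moreover have "e1 \<noteq> 0" using e11 by auto
  ultimately show ?thesis by (simp add: blinfun.bilinear_simps)
qed

lemma h_commute: "0 < a \<Longrightarrow> 0 < b \<Longrightarrow> h a b = h b a"
  by (simp add: h_def mean_sym)

text \<open>If every chord of every \<open>h t\<close> passes through the origin, then commutativity
  gives h t a = k t a. The case a = t yields g t = k t^2 since f 1 = 1, and the case t = 1 then
  yields f = sqrt, which is already refuted.\<close>

lemma exists_nonzero_intercept:
  obtains t a a' where "0 < t" "0 < a" "a < a'" "chord_icpt (h t) a a' \<noteq> 0"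
proof (rule ccontr)
  assume n: "\<not> thesis"
  note witness = that
  have z: "chord_icpt (h t) a a' = 0" if "0 < t" "0 < a" "a < a'" for t a a'
    using witness[OF that] n by blast
  have *: "a' * h t a = a * h t a'" if "0 < t" "0 < a" "a < a'" for t a a'
    using z[OF that] that by (simp add: chord_icpt_def)
  have lin: "h t a = a * h t 1" if "0 < t" "0 < a" for t a
    using *[OF that(1), of a 1] *[OF that(1), of 1 a] that by (cases a "1::real" rule: linorder_cases) auto
  define k where "k = h 1 1"
  have k: "0 < k" by (simp add: k_def h_pos)
  have hk: "h t a = k * (t * a)" if "0 < t" "0 < a" for t a
    using lin[OF that] lin[of 1 t] h_commute[of t 1] that by (simp add: k_def)
  have gk: "g t = k * t\<^sup>2" if "0 < t" for t
    using hk[OF that that] that by (simp add: h_def f_one power2_eq_square)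
  have "f t = sqrt t" if "0 < t" for t
  proof -
    have "k * (f t)\<^sup>2 = k * t" using hk[of 1 t] gk[OF f_pos[OF that]] that by (simp add: h_def)
    then have "(f t)\<^sup>2 = t" using k by simp
    then show ?thesis using f_pos[OF that] by (metis less_imp_le real_sqrt_unique)
  qed
  then show False using geometric_mean_not_associative gk k by blast
qed

section \<open>From one chord with nonzero intercept to a power law\<close>

context
  fixes t a\<^sub>0 a\<^sub>1 :: real
  assumes t: "0 < t" and a01: "0 < a\<^sub>0" "a\<^sub>0 < a\<^sub>1" and icpt0: "chord_icpt (h t) a\<^sub>0 a\<^sub>1 \<noteq> 0"
begin

text \<open>For fixed \<open>c\<close> and \<open>c'\<close> the right-hand side of \<open>ratio_identity\<close> does not depend on the angle
  between the eigenbases, which lets \<open>k' / k\<close> vary while \<open>k * k'\<close> stays fixed.\<close>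

lemma ratio_product:
  assumes k: "0 < k" "k < k'"
  shows "ratio k k' = \<Phi> (k * k')"
proof -
  let ?H = "h t"
  define s where "s = ?H a\<^sub>0"
  define s' where "s' = ?H a\<^sub>1"
  have s: "0 < s" "s < s'" using t a01 by (auto simp: s_def s'_def h_pos h_strict)
  define l where "l = s' / s"
  have l: "1 < l" using s by (simp add: l_def)
  define \<rho> where "\<rho> = sqrt (k * k')"
  have \<rho>: "0 < \<rho>" using k by (simp add: \<rho>_def)
  define F where "F \<eta> = ratio (\<rho> / \<eta>) (\<rho> * \<eta>)" for \<eta>
  have step: "\<exists>K. \<forall>\<eta>\<in>{y<..<y * l}. F \<eta> = K" if y: "1 \<le> y" for y
  proof -
    \<comment> \<open>With this choice aligned eigenbases realise \<eta> = y and crossed ones \<eta>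
      = y l, always with product \<rho>^2; the angles in between realise every \<eta> between them,
      while \<open>c\<close> and \<open>c'\<close> stay fixed.\<close>
    define c where "c = s * (\<rho> / y)"
    define c' where "c' = s' * (\<rho> * y)"
    have c: "0 < c" using s \<rho> y by (simp add: c_def)
    have "\<rho> / y \<le> \<rho>" "\<rho> \<le> \<rho> * y" using y \<rho> by (simp_all add: divide_le_eq)
    then have "\<rho> / y \<le> \<rho> * y" by linarith
    then have cc: "c < c'" unfolding c_def c'_def using s \<rho> y by (intro mult_less_le_imp_less) auto
    define K where "K = chord_icpt ?H c c' / (chord_icpt ?H a\<^sub>0 a\<^sub>1 * chord_slope ?H c c')"
    have "F \<eta> = K" if \<eta>: "y < \<eta>" "\<eta> < y * l" for \<eta>
    proof -
      define T1 where "T1 = y + 1 / y"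
      define T2 where "T2 = y * l + 1 / (y * l)"
      define S where "S = \<eta> + 1 / \<eta>"
      have lt: "T1 < S" "S < T2"
        unfolding T1_def T2_def S_def using y \<eta> by (auto intro!: add_inverse_strict_mono)
      define x where "x = (T2 - S) / (T2 - T1)"
      have x: "0 < x" "x < 1" using lt by (auto simp: x_def)
      have "x * (T2 - T1) = T2 - S" using lt by (simp add: x_def)
      then have xS: "x * T1 + (1 - x) * T2 = S" by (simp add: algebra_simps)
      have T: "c / s + c' / s' = \<rho> * T1" "c / s' + c' / s = \<rho> * T2"
        using s y by (simp_all add: c_def c'_def T1_def T2_def l_def field_simps)
      have "\<rho> / \<eta> + \<rho> * \<eta> = \<rho> * (x * T1 + (1 - x) * T2)"
        unfolding xS by (simp add: S_def algebra_simps)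
      also have "\<dots> = x * (c / s + c' / s') + (1 - x) * (c / s' + c' / s)"
        unfolding T by (simp add: algebra_simps)
      finally have sum: "\<rho> / \<eta> + \<rho> * \<eta> = x * (c / s + c' / s') + (1 - x) * (c / s' + c' / s)" .
      have prod: "\<rho> / \<eta> * (\<rho> * \<eta>) = c * c' / (s * s')"
        using y \<eta> s by (simp add: c_def c'_def field_simps)
      have "1 < \<eta>" using y \<eta> by simp
      then have "1 < \<eta> * \<eta>" by (rule less_1_mult) fact
      then have kk: "0 < \<rho> / \<eta>" "\<rho> / \<eta> < \<rho> * \<eta>" using \<rho> \<open>1 < \<eta>\<close> by (auto simp: field_simps)
      have "F \<eta> * chord_icpt ?H a\<^sub>0 a\<^sub>1 * chord_slope ?H c c' = chord_icpt ?H c c'"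
        unfolding F_def
        by (rule ratio_identity[OF t _ _ _ _ _ _ x kk sum[unfolded s_def s'_def] prod[unfolded s_def s'_def]])
          (use a01 c cc in auto)
      then show ?thesis
        using chord_slope_h_pos[OF t c cc] icpt0 by (simp add: K_def field_simps)
    qed
    then show ?thesis by auto
  qed
  have const: "F \<eta> = F \<eta>'" if "1 < \<eta>" "1 < \<eta>'" for \<eta> \<eta>'
  proof (rule connected_local_const[where A = "{1<..}" and f = F and a = \<eta> and b = \<eta>'])
    show "\<forall>u\<in>{1<..}. \<forall>\<^sub>F v in at u within {1<..}. F u = F v"
    proof
      fix u :: real assume "u \<in> {1<..}"
      then have u: "1 < u" by simp
      \<comment> \<open>The window from \<open>y\<close> to \<open>y * l\<close> is centred
        geometrically at \<open>u\<close>, unless that would push it below 1.\<close>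
      define y where "y = max 1 (u / sqrt l)"
      have "1 < sqrt l" using l by simp
      then have y: "1 \<le> y" "y < u" "u < y * l"
      proof -
        show "1 \<le> y" by (simp add: y_def)
        have "u < u * sqrt l" using u \<open>1 < sqrt l\<close> by simp
        then have "u / sqrt l < u" using \<open>1 < sqrt l\<close> by (simp add: field_simps)
        then show "y < u" using u by (simp add: y_def)
        have "u / sqrt l * l = u * sqrt l" using l by (simp add: field_simps)
        moreover have "u / sqrt l * l \<le> y * l" using l by (intro mult_right_mono) (auto simp: y_def)
        ultimately show "u < y * l" using \<open>u < u * sqrt l\<close> by simp
      qed
      then obtain K where K: "\<forall>\<eta>\<in>{y<..<y * l}. F \<eta> = K" using step by blast
      then show "\<forall>\<^sub>F v in at u within {1<..}. F u = F v"
        unfolding eventually_at_topological by (intro exI[of _ "{y<..<y * l}"]) (use y in auto)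
    qed
  qed (use that in auto)
  define \<eta> where "\<eta> = sqrt (k' / k)"
  have "1 < \<eta>" using k by (simp add: \<eta>_def)
  have "\<rho> / \<eta> = sqrt ((k * k') / (k' / k))" "\<rho> * \<eta> = sqrt ((k * k') * (k' / k))"
    by (simp_all only: \<rho>_def \<eta>_def real_sqrt_divide real_sqrt_mult)
  moreover have "(k * k') / (k' / k) = k\<^sup>2" "(k * k') * (k' / k) = k'\<^sup>2"
    using k by (simp_all add: power2_eq_square)
  ultimately have "\<rho> / \<eta> = k" "\<rho> * \<eta> = k'" using k by simp_all
  then have "ratio k k' = F \<eta>" by (simp add: F_def)
  also have "\<dots> = F 2" by (rule const) (use \<open>1 < \<eta>\<close> in auto)
  finally show ?thesis by (simp add: F_def \<Phi>_def \<rho>_def)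
qed

text \<open>On the reciprocal pair 1/2, 2 symmetry makes intercept and slope of the chord
  equal.\<close>

lemma \<Phi>_one: "\<Phi> 1 = 1"
proof -
  have "2 * f (1/2) = f 2" using f_sym[of 2] by simp
  moreover have "f (1/2) < f 2" by (rule f_strict) auto
  ultimately show ?thesis
    by (simp add: \<Phi>_def ratio_def chord_icpt_def chord_slope_def)
qed

text \<open>For fixed c and c' the identity has the same right-hand side for the pairs a, a' and
  \<open>a\<^sub>0\<close>, \<open>a\<^sub>1\<close>. Hence the quotient of \<Phi> (z w) by \<Phi> z
  does not depend on z, and z = 1 evaluates it.\<close>

lemma \<Phi>_step:
  assumes a: "0 < a" "a < a'" and w: "w = h t a\<^sub>0 * h t a\<^sub>1 / (h t a * h t a')" and y: "0 < y"
  shows "\<Phi> (y * w) = \<Phi> y * \<Phi> w"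
proof -
  let ?H = "h t"
  have id: "\<Phi> (x / (?H b * ?H b')) * chord_icpt ?H b b' = chord_icpt ?H (sqrt x / 2) (sqrt x * 2) / chord_slope ?H (sqrt x / 2) (sqrt x * 2)"
    if b: "0 < b" "b < b'" and x: "0 < x" for b b' x
  proof -
    define c where "c = sqrt x / 2"
    define c' where "c' = sqrt x * 2"
    have c: "0 < c" "c < c'" "c * c' = x" using x by (auto simp: c_def c'_def)
    have "?H b < ?H b'" "0 < ?H b" using t b by (auto simp: h_strict h_pos)
    then obtain k k' where k: "0 < k" "k < k'"
      "k + k' = 1/2 * (c / ?H b + c' / ?H b') + (1 - 1/2) * (c / ?H b' + c' / ?H b)"
      "k * k' = c * c' / (?H b * ?H b')"
      using interlaced_roots[of "?H b" "?H b'" c c' "1/2"] c by auto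
    have "ratio k k' * chord_icpt ?H b b' * chord_slope ?H c c' = chord_icpt ?H c c'"
      by (rule ratio_identity[OF t _ _ _ _ _ _ _ _ k]) (use b c in auto)
    moreover have "ratio k k' = \<Phi> (x / (?H b * ?H b'))" using ratio_product[OF k(1,2)] k(4) c(3) by simp
    ultimately show ?thesis
      using chord_slope_h_pos[OF t c(1,2)] by (simp add: c_def[symmetric] c'_def[symmetric] field_simps)
  qed
  define D0 where "D0 = ?H a\<^sub>0 * ?H a\<^sub>1"
  define D where "D = ?H a * ?H a'"
  have D: "0 < D0" "0 < D" using t a a01 by (auto simp: D0_def D_def h_pos)
  have eq: "\<Phi> (z * w) * chord_icpt ?H a a' = \<Phi> z * chord_icpt ?H a\<^sub>0 a\<^sub>1" if "0 < z" for z
    using id[OF a, of "z * D0"] id[OF a01, of "z * D0"] that D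
    by (simp add: w D0_def[symmetric] D_def[symmetric])
  have w1: "\<Phi> w * chord_icpt ?H a a' = chord_icpt ?H a\<^sub>0 a\<^sub>1" using eq[of 1] \<Phi>_one by simp
  then have "chord_icpt ?H a a' \<noteq> 0" using icpt0 by auto
  moreover have "\<Phi> (y * w) * chord_icpt ?H a a' = \<Phi> y * \<Phi> w * chord_icpt ?H a a'"
    using eq[OF y] w1 by (simp add: ac_simps)
  ultimately show ?thesis by simp
qed

text \<open>The multipliers w that work for all y form a group. It contains the quotients of values
  of \<open>h t\<close>, hence by continuity an interval starting at 1; powers of its elements reach
  every number above 1, and inverses the rest.\<close>

lemma \<Phi>_mult:
  assumes "0 < y" "0 < w"
  shows "\<Phi> (y * w) = \<Phi> y * \<Phi> w"
proof -
  let ?H = "h t"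
  define G where "G w \<longleftrightarrow> 0 < w \<and> (\<forall>y>0. \<Phi> (y * w) = \<Phi> y * \<Phi> w)" for w
  have Gmult: "G (u * v)" if "G u" "G v" for u v
  proof -
    have "\<Phi> (y * (u * v)) = \<Phi> y * \<Phi> (u * v)" if "0 < y" for y
    proof -
      have "\<Phi> (y * u * v) = \<Phi> y * \<Phi> u * \<Phi> v" using \<open>G u\<close> \<open>G v\<close> that by (simp add: G_def)
      moreover have "\<Phi> (u * v) = \<Phi> u * \<Phi> v" using \<open>G u\<close> \<open>G v\<close> by (simp add: G_def)
      ultimately show ?thesis by (simp add: ac_simps)
    qed
    then show ?thesis using that by (simp add: G_def)
  qed
  have Ginv: "G (1 / u)" if "G u" for u
  proof -
    have u: "0 < u" using that by (simp add: G_def)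
    have *: "\<Phi> y = \<Phi> (y / u) * \<Phi> u" if "0 < y" for y
    proof -
      have "\<Phi> (y / u * u) = \<Phi> (y / u) * \<Phi> u" using \<open>G u\<close> u that by (simp only: G_def divide_pos_pos)
      then show ?thesis using u by simp
    qed
    have "\<Phi> (y * (1 / u)) = \<Phi> y * \<Phi> (1 / u)" if "0 < y" for y
    proof -
      have one: "\<Phi> (1 / u) * \<Phi> u = 1" using *[of 1] \<Phi>_one by simp
      have "\<Phi> y * \<Phi> (1 / u) = \<Phi> (y / u) * (\<Phi> (1 / u) * \<Phi> u)"
        unfolding *[OF that] by (simp only: ac_simps)
      then show ?thesis unfolding one by simp
    qed
    moreover have "0 < 1 / u" using u by simp
    ultimately show ?thesis unfolding G_def by blast
  qed
  have G1: "G 1" by (simp add: G_def \<Phi>_one)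
  have Gpow: "G (u ^ n)" if "G u" for u n
    by (induction n) (simp_all add: G1 Gmult that)
  have GH: "G (?H b / ?H a\<^sub>0)" if "0 < b" for b
  proof -
    \<comment> \<open>A common upper partner for \<open>b\<close> and \<open>a\<^sub>0\<close>: in
      the quotient of the two multipliers the factor \<open>h t d\<close> cancels.\<close>
    define d where "d = max b a\<^sub>0 + 1"
    have d: "b < d" "a\<^sub>0 < d" by (auto simp: d_def)
    have pos: "0 < ?H b" "0 < ?H a\<^sub>0" "0 < ?H a\<^sub>1" "0 < ?H d" using t a01 that d by (auto intro!: h_pos)
    have "G (?H a\<^sub>0 * ?H a\<^sub>1 / (?H b * ?H d))" "G (?H a\<^sub>0 * ?H a\<^sub>1 / (?H a\<^sub>0 * ?H d))"
      unfolding G_def using \<Phi>_step[OF that d(1) refl] \<Phi>_step[OF a01(1) d(2) refl] pos by auto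
    then have "G (?H a\<^sub>0 * ?H a\<^sub>1 / (?H a\<^sub>0 * ?H d) * (1 / (?H a\<^sub>0 * ?H a\<^sub>1 / (?H b * ?H d))))"
      by (intro Gmult Ginv)
    then show ?thesis using pos by (simp add: field_simps)
  qed
  define L where "L = ?H a\<^sub>1 / ?H a\<^sub>0"
  have H0: "0 < ?H a\<^sub>0" using t a01 by (auto intro!: h_pos)
  have L: "1 < L" using h_strict[OF t a01] H0 by (simp add: L_def)
  have Gsmall: "G u" if u: "1 \<le> u" "u \<le> L" for u
  proof -
    have "\<exists>b\<ge>a\<^sub>0. b \<le> a\<^sub>1 \<and> ?H b = u * ?H a\<^sub>0"
    proof (rule IVT')
      show "?H a\<^sub>0 \<le> u * ?H a\<^sub>0" "u * ?H a\<^sub>0 \<le> ?H a\<^sub>1" using u H0 by (auto simp: L_def field_simps)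
      show "continuous_on {a\<^sub>0..a\<^sub>1} ?H"
        by (rule continuous_on_subset[OF h_continuous[OF t]]) (use a01 in auto)
    qed (use a01 in auto)
    then obtain b where b: "a\<^sub>0 \<le> b" "?H b = u * ?H a\<^sub>0" by blast
    then have "G (u * ?H a\<^sub>0 / ?H a\<^sub>0)" using GH[of b] a01 by simp
    then show ?thesis using H0 by simp
  qed
  have Gbig: "G u" if u: "1 < u" for u
  proof -
    obtain n where n: "u < L ^ n" using real_arch_pow[OF L] by blast
    have "n \<noteq> 0" using n u by (intro notI) simp
    then have n0: "0 < n" by simp
    define v where "v = root n u"
    have vn: "v ^ n = u" using n0 u by (simp add: v_def)
    have "1 \<le> v" using n0 u by (simp add: v_def)
    moreover have "v \<le> L"
    proof (rule ccontr)
      assume "\<not> v \<le> L"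
      then have "L ^ n \<le> v ^ n" using L by (intro power_mono) auto
      then show False using n vn by simp
    qed
    ultimately have "G (v ^ n)" by (intro Gpow Gsmall)
    then show ?thesis by (simp add: vn)
  qed
  have "G w"
  proof (cases w "1::real" rule: linorder_cases)
    case less
    then have "G (1 / (1 / w))" using assms by (intro Ginv Gbig) simp
    then show ?thesis by simp
  qed (use G1 Gbig in auto)
  then show ?thesis using assms by (simp add: G_def)
qed

lemma f_eq_\<Phi>:
  assumes "1 < x"
  shows "f x = (x + \<Phi> x) / (1 + \<Phi> x)" "\<Phi> x = (x - f x) / (f x - 1)" "1 < f x"
proof -
  show f1: "1 < f x" using f_strict[of 1 x] assms f_one by simp
  show e: "\<Phi> x = (x - f x) / (f x - 1)"
    using ratio_product[of 1 x] assms by (simp add: ratio_def chord_icpt_def chord_slope_def f_one)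
  then have "\<Phi> x * (f x - 1) = x - f x" using f1 by simp
  then have "f x * (1 + \<Phi> x) = x + \<Phi> x" by (simp add: algebra_simps)
  then show "f x = (x + \<Phi> x) / (1 + \<Phi> x)" using \<Phi>_pos[of x] assms by (simp add: field_simps)
qed

text \<open>Evaluating the ratio at the pair \<open>x, x\<^sup>2\<close> gives, with \<open>y = \<Phi> x\<close>, the equation
  \<open>y (y - 1) (x - y) (x - 1) (x - y\<^sup>2) = 0\<close>.\<close>

lemma \<Phi>_cases:
  assumes x: "1 < x"
  shows "\<Phi> x = 1 \<or> \<Phi> x = x \<or> \<Phi> x = sqrt x"
proof -
  define y where "y = \<Phi> x"
  have y: "0 < y" using x by (simp add: y_def \<Phi>_pos)
  have x2: "x < x * x" "1 < x * x" using x by (auto simp: less_1_mult)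
  have y2: "\<Phi> (x * x) = y * y" "\<Phi> (x * (x * x)) = y * (y * y)"
    using x by (simp_all add: \<Phi>_mult y_def)
  have "ratio x (x * x) = y * (y * y)" using ratio_product[of x "x * x"] x x2 y2 by simp
  then have *: "x * x * f x - x * f (x * x) = y * (y * y) * (f (x * x) - f x)"
    using ratio_mult[of x "x * x"] x x2 by simp
  define p where "p = f x"
  define q where "q = f (x * x)"
  have "1 + y \<noteq> 0" "1 + y * y \<noteq> 0" using y by (auto simp: add_pos_pos less_imp_neq[symmetric])
  then have p: "p * (1 + y) = x + y" and q: "q * (1 + y * y) = x * x + y * y"
    using f_eq_\<Phi>(1)[OF x] f_eq_\<Phi>(1)[OF x2(2)] y2 by (simp_all add: p_def q_def y_def[symmetric])
  have "(x * x * p - x * q - y * (y * y) * (q - p)) * ((1 + y) * (1 + y * y)) = 0"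
    using * by (simp add: p_def q_def)
  moreover have "(x * x * p - x * q - y * (y * y) * (q - p)) * ((1 + y) * (1 + y * y))
     = (x * x + y * (y * y)) * (p * (1 + y)) * (1 + y * y) - (x + y * (y * y)) * (q * (1 + y * y)) * (1 + y)"
    by (simp add: algebra_simps)
  ultimately have "(x * x + y * (y * y)) * (x + y) * (1 + y * y) - (x + y * (y * y)) * (x * x + y * y) * (1 + y) = 0"
    unfolding p q by simp
  moreover have "(x * x + y * (y * y)) * (x + y) * (1 + y * y) - (x + y * (y * y)) * (x * x + y * y) * (1 + y)
      = y * (y - 1) * (x - y) * (x - 1) * (x - y * y)"
    by (simp add: algebra_simps)
  ultimately have "y = 1 \<or> x = y \<or> x = y * y" using x y by auto
  moreover have "sqrt (y * y) = y" using y by simp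
  ultimately show ?thesis unfolding y_def[symmetric] by auto
qed

text \<open>The three alternatives are known only pointwise; the exponent is continuous with
  finitely many values on a connected set, so one of them holds throughout.\<close>

lemma exponent_constant:
  obtains r where "r = 0 \<or> r = 1 \<or> r = 1 / 2" "\<And>x. 1 < x \<Longrightarrow> \<Phi> x = x powr r"
proof -
  define \<theta> where "\<theta> x = ln (\<Phi> x) / ln x" for x
  have \<theta>: "\<theta> x = 0 \<or> \<theta> x = 1 \<or> \<theta> x = 1 / 2" "\<Phi> x = x powr \<theta> x" if "1 < x" for x
  proof -
    have "0 < ln x" using that by simp
    show "\<theta> x = 0 \<or> \<theta> x = 1 \<or> \<theta> x = 1 / 2"
      using \<Phi>_cases[OF that] \<open>0 < ln x\<close> that by (auto simp: \<theta>_def ln_sqrt)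
    show "\<Phi> x = x powr \<theta> x" using \<Phi>_pos[of x] that \<open>0 < ln x\<close> by (simp add: powr_def \<theta>_def)
  qed
  have cf: "continuous_on {1<..} f" by (rule continuous_on_subset[OF f_cont]) auto
  have "continuous_on {1<..} \<Phi> \<longleftrightarrow> continuous_on {1<..} (\<lambda>x. (x - f x) / (f x - 1))"
    by (rule continuous_on_cong) (auto simp: f_eq_\<Phi>(2))
  also have "\<dots>" using f_eq_\<Phi>(3) by (force intro!: continuous_intros cf)
  finally have "continuous_on {1<..} \<Phi>" .
  moreover have "\<Phi> x \<noteq> 0" if "1 < x" for x using \<Phi>_pos[of x] that by simp
  ultimately have "continuous_on {1<..} \<theta>"
    unfolding \<theta>_def by (intro continuous_intros) auto
  moreover have "finite (\<theta> ` {1<..})"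
  proof (rule finite_subset)
    show "\<theta> ` {1<..} \<subseteq> {0, 1, 1/2}"
    proof (rule image_subsetI)
      fix x :: real assume "x \<in> {1<..}"
      then show "\<theta> x \<in> {0, 1, 1/2}" using \<theta>(1)[of x] by simp
    qed
  qed simp
  ultimately have "\<theta> constant_on {1<..}" by (intro continuous_finite_range_constant) auto
  then obtain r where r: "\<And>x. 1 < x \<Longrightarrow> \<theta> x = r" unfolding constant_on_def by auto
  show thesis
    by (rule that[of r]) (use \<theta>[of 2] \<theta>(2) r in auto)
qed

lemma f_extend:
  assumes e: "\<And>x. 1 < x \<Longrightarrow> f x = F x" and F: "F 1 = 1" "\<And>x. 0 < x \<Longrightarrow> x * F (1 / x) = F x" and x: "0 < x"
  shows "f x = F x"
proof (cases x "1::real" rule: linorder_cases)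
  case less
  then have "f (1 / x) = F (1 / x)" using x by (intro e) simp
  then show ?thesis using f_sym[OF x] F(2)[OF x] by simp
qed (use e F f_one in auto)

lemma f_cases_aux: "(\<forall>x>0. f x = (1 + x) / 2) \<or> (\<forall>x>0. f x = 2 * x / (1 + x))"
proof -
  obtain r where r: "r = 0 \<or> r = 1 \<or> r = 1 / 2" and \<Phi>: "\<And>x. 1 < x \<Longrightarrow> \<Phi> x = x powr r"
    using exponent_constant by metis
  consider "r = 0" | "r = 1" | "r = 1 / 2" using r by blast
  then show ?thesis
  proof cases
    case 1
    have "f x = (1 + x) / 2" if "0 < x" for x
    proof (rule f_extend[OF _ _ _ that])
      show "f x = (1 + x) / 2" if "1 < x" for x
        using f_eq_\<Phi>(1)[OF that] \<Phi>[OF that] that 1 by simp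
    qed (auto simp: field_simps)
    then show ?thesis by blast
  next
    case 2
    have "f x = 2 * x / (1 + x)" if "0 < x" for x
    proof (rule f_extend[OF _ _ _ that])
      show "f x = 2 * x / (1 + x)" if "1 < x" for x
        using f_eq_\<Phi>(1)[OF that] \<Phi>[OF that] that 2 by simp
    qed (auto simp: field_simps)
    then show ?thesis by blast
  next
    case 3
    have sq: "x * sqrt (1 / x) = sqrt x" if "0 < x" for x :: real
      using that by (simp add: real_sqrt_divide real_div_sqrt)
    have fs: "f x = sqrt x" if "0 < x" for x
    proof (rule f_extend[OF _ _ _ that])
      show "f x = sqrt x" if "1 < x" for x
      proof -
        have "\<Phi> x = sqrt x" using \<Phi>[OF that] that 3 by (simp add: powr_half_sqrt)
        moreover have "x + sqrt x = sqrt x * (1 + sqrt x)" using that by (simp add: algebra_simps)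
        moreover have "0 < 1 + sqrt x" using that by (simp add: add_pos_pos)
        ultimately show ?thesis using f_eq_\<Phi>(1)[OF that] by simp
      qed
    qed (simp_all add: sq)
    \<comment> \<open>With f = sqrt the law for the scalars x, t, 1 reads sqrt (h x t) = sqrt (x * h
      t 1), so all chords of \<open>h t\<close> pass through the origin, contrary to
      \<open>icpt0\<close>.\<close>
    have lin: "h t x = x * h t 1" if "0 < x" for x
    proof -
      have hp: "0 < h x t" "0 < h t 1" using that t by (auto intro!: h_pos)
      have "h x t * sqrt (1 / h x t) = x * sqrt (h t 1 / x)"
        using scalar_assoc[OF that t, of 1] fs that hp by simp
      moreover have "x * sqrt (h t 1 / x) = x * sqrt (1 / x) * sqrt (h t 1)"
        by (simp add: real_sqrt_divide)
      ultimately have "sqrt (h x t) = sqrt (x * h t 1)"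
        unfolding sq[OF hp(1)] sq[OF that] real_sqrt_mult by simp
      then show ?thesis using h_commute[OF that t] by simp
    qed
    have "chord_icpt (h t) a\<^sub>0 a\<^sub>1 = 0"
      using lin[of a\<^sub>0] lin[of a\<^sub>1] a01 by (simp add: chord_icpt_def)
    then show ?thesis using icpt0 by simp
  qed
qed

end

lemma f_cases: "(\<forall>x>0. f x = (1 + x) / 2) \<or> (\<forall>x>0. f x = 2 * x / (1 + x))"
proof -
  obtain t a a' where "0 < t" "0 < a" "a < a'" "chord_icpt (h t) a a' \<noteq> 0"
    by (rule exists_nonzero_intercept)
  then show ?thesis by (rule f_cases_aux)
qed

end

theorem theorem8:
  fixes f g :: "real \<Rightarrow> real"
  assumes dimH: "\<exists>x y::'a::chilbert. x \<noteq> 0 \<and> (\<forall>c. y \<noteq> cscale c x)"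
    and infB: "infinite_dim TYPE('b::chilbert)"
    and f_opmono: "op_monotone TYPE('b) f"
    and f_pos: "\<forall>t>0. f t > 0"
    and f_one: "f 1 = 1"
    and f_sym: "\<forall>t>0. t * f (1 / t) = f t"
    and g_cont: "continuous_on {0<..} g"
    and g_mono: "strict_mono_on {0<..} g"
    and g_surj: "g ` {0<..} = {0<..}"
    and assoc: "\<forall>A\<in>(PD::('a \<Rightarrow>\<^sub>L 'a) set). \<forall>B\<in>PD. \<forall>C\<in>PD.
       fcalc g (kubo_ando f (fcalc g (kubo_ando f A B)) C)
       = fcalc g (kubo_ando f A (fcalc g (kubo_ando f B C)))"
  shows "(\<forall>A\<in>(PD::('a \<Rightarrow>\<^sub>L 'a) set). \<forall>B\<in>PD. kubo_ando f A B = (1/2) *\<^sub>R (A + B))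
       \<or> (\<forall>A\<in>(PD::('a \<Rightarrow>\<^sub>L 'a) set). \<forall>B\<in>PD. kubo_ando f A B = 2 *\<^sub>R op_inv (op_inv A + op_inv B))"
proof -
  obtain e1 e2 :: 'a where "orthonormal_pair e1 e2"
    using dimH orthonormal_pair_exists by metis
  then interpret H: orthonormal_pair e1 e2 .
  \<comment> \<open>Operator monotonicity is exploited on \<open>'b\<close>, so an orthonormal pair
    is needed there too: \<open>u\<close> and \<open>imult u\<close> span a complex line, which
    cannot be all of \<open>'b\<close>.\<close>
  have span: "span S \<noteq> (UNIV :: 'b set)" if "finite S" for S
    using infB that by (simp add: infinite_dim_def)
  obtain u :: 'b where u: "u \<noteq> 0" using span[of "{}"] by auto
  obtain v :: 'b where v: "v \<notin> span {u, imult u}" using span[of "{u, imult u}"] by auto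
  have "cscale c u \<in> span {u, imult u}" for c
    unfolding cscale_def by (intro span_add span_scale span_base) auto
  then have "v \<noteq> cscale c u" for c using v by metis
  with u obtain d1 d2 :: 'b where "orthonormal_pair d1 d2"
    using orthonormal_pair_exists by metis
  then interpret B: orthonormal_pair d1 d2 .
  \<comment> \<open>Symmetry at 2 excludes a constant \<open>f\<close>, because f 2 is positive and
    twice f (1/2).\<close>
  have "2 * f (1/2) = f 2" "0 < f 2" using f_sym[rule_format, of 2] f_pos by auto
  then have nonconst: "f (1/2) \<noteq> f 2" by auto
  have f_strict: "f s < f t" if "0 < s" "s < t" for s t
    by (rule B.op_monotone_strict[OF f_opmono _ _ nonconst that]) auto
  interpret associative_mean e1 e2 f g
    using f_opmono f_pos f_one f_sym g_cont g_mono g_surj assoc f_strict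
    by unfold_locales (auto simp: op_monotone_def)
  show ?thesis
    using f_cases
  proof
    assume "\<forall>x>0. f x = (1 + x) / 2"
    then show ?thesis using kubo_ando_arithmetic[of f] by blast
  next
    assume "\<forall>x>0. f x = 2 * x / (1 + x)"
    then show ?thesis using kubo_ando_harmonic[of f] by blast
  qed
qed

end
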